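(* Let $d\ge 1$ be a real number, let $n\ge 1$, and let $\mathbf X=(X_1,\dots,X_n)$, where $X_1,\dots,X_n\in L^d(\Omega,\mathcal F,\mathbf P)$ are nondegenerate independent and identically distributed real-valued random variables. Then the function $|||\cdot|||_{\mathbf X,d}:M_n\to\mathbb R$ defined by $$|||Z|||_{\mathbf X,d}:=\left(\frac{1}{2\pi\binom{d}{d/2}}\int_0^{2\pi}\big\|e^{it}Z+e^{-it}Z^*\big\|_{\mathbf X,d}^d\,\mathrm dt\right)^{1/d}$$ is a norm on $M_n$ that extends $\|\cdot\|_{\mathbf X,d}$, i.e. $|||A|||_{\mathbf X,d}=\|A\|_{\mathbf X,d}$ for every $A\in H_n$.
   Context: $M_n$ denotes the complex vector space of $n\times n$ complex matrices and $H_n$ the real vector space of $n\times n$ Hermitian matrices. A random variable is nondegenerate if it is not almost surely constant. For $A\in H_n$ with vector of (real) eigenvalues $\boldsymbol\lambda\in\mathbb R^n$ (listed with multiplicity; the order is irrelevant because the entries of $\mathbf X$ are iid), $$\|A\|_{\mathbf X,d}:=\left(\frac{\mathbb E\big[|\langle \mathbf X,\boldsymbol\lambda\rangle|^d\big]}{\Gamma(d+1)}\right)^{1/d},$$ where $\langle\cdot,\cdot\rangle$ is the usual inner product on $\mathbb R^n$ and $\Gamma$ is the gamma function. It is known (from earlier work) that $\|\cdot\|_{\mathbf X,d}$ is a norm on $H_n$ for every $d\ge 1$. The binomial coefficient is interpreted as $\binom{d}{d/2}:=\Gamma(d+1)/\Gamma(\frac d2+1)^2$. *)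

theory Defs
  imports
    "HOL-Probability.Probability"
    "Jordan_Normal_Form.Schur_Decomposition"
begin

definition hermitian_mats :: "nat \<Rightarrow> complex mat set" where
  "hermitian_mats n = {A \<in> carrier_mat n n. mat_adjoint A = A}"

text \<open>
  The real eigenvalues of a Hermitian matrix with multiplicity, in ascending order: \<open>proots\<close>
  is the multiset of roots, and taking \<open>Re\<close> only changes the type, as all eigenvalues of a
  Hermitian matrix are real. The function is only meaningful on Hermitian matrices.
\<close>
definition hermitian_eigvals :: "complex mat \<Rightarrow> real list" where
  "hermitian_eigvals A = sorted_list_of_multiset (image_mset Re (proots (char_poly A)))"

text \<open>
  The random vector is given by its components \<open>X 0, \<dots>, X (n - 1)\<close>, where \<open>n\<close> is the
  dimension of the matrix.
\<close>
definition random_vector_norm ::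
    "'a measure \<Rightarrow> (nat \<Rightarrow> 'a \<Rightarrow> real) \<Rightarrow> real \<Rightarrow> complex mat \<Rightarrow> real" where
  "random_vector_norm M X d A =
     ((LINT \<omega>|M. \<bar>\<Sum>i<dim_row A. X i \<omega> * hermitian_eigvals A ! i\<bar> powr d)
        / Gamma (d + 1)) powr (1 / d)"

definition central_binomial :: "real \<Rightarrow> real" where
  "central_binomial d = Gamma (d + 1) / (Gamma (d / 2 + 1))\<^sup>2"

definition random_vector_norm_ext ::
    "'a measure \<Rightarrow> (nat \<Rightarrow> 'a \<Rightarrow> real) \<Rightarrow> real \<Rightarrow> complex mat \<Rightarrow> real" where
  "random_vector_norm_ext M X d Z =
     (1 / (2 * pi * central_binomial d) *
        (LINT t:{0..2 * pi}|lborel.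
           random_vector_norm M X d
             (exp (\<i> * complex_of_real t) \<cdot>\<^sub>m Z
                + exp (- (\<i> * complex_of_real t)) \<cdot>\<^sub>m mat_adjoint Z) powr d)) powr (1 / d)"

definition norm_on_complex_mats :: "nat \<Rightarrow> (complex mat \<Rightarrow> real) \<Rightarrow> bool" where
  "norm_on_complex_mats n N \<longleftrightarrow>
     (\<forall>Z \<in> carrier_mat n n. 0 \<le> N Z) \<and>
     (\<forall>Z \<in> carrier_mat n n. N Z = 0 \<longleftrightarrow> Z = 0\<^sub>m n n) \<and>
     (\<forall>Z \<in> carrier_mat n n. \<forall>c. N (c \<cdot>\<^sub>m Z) = cmod c * N Z) \<and>
     (\<forall>Z \<in> carrier_mat n n. \<forall>W \<in> carrier_mat n n. N (Z + W) \<le> N Z + N W)"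

end

theory Submission
  imports Defs
begin

text \<open>
  Let \<open>F l\<close> be the \<open>L\<^sup>d\<close> norm of \<open>\<langle>X, l\<rangle>\<close>, normalised as in the statement. It is a norm on real
  vectors by Minkowski's inequality; it is definite because a nondegenerate variable is not
  almost surely equal to one that is independent of it. As \<open>X\<close> is iid, \<open>F\<close> is invariant under
  permutations, so \<open>F (S l) \<le> F l\<close> for doubly stochastic \<open>S\<close>. In an eigenbasis of \<open>A + B\<close> the
  diagonals of \<open>A\<close> and \<open>B\<close> add up to the eigenvalues of \<open>A + B\<close>, and each of them is the image of
  the eigenvalues of its matrix under a doubly stochastic matrix. Hence \<open>F\<close> of the eigenvalues
  is a norm on Hermitian matrices.

  Every norm on Hermitian matrices extends in this way. The Hermitian matrix
  \<open>exp (it) Z + exp (- it) Z\<^sup>*\<close> is additive in \<open>Z\<close>, so Minkowski's inequality in \<open>t\<close> gives the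
  triangle inequality; multiplying \<open>Z\<close> by a phase only shifts the periodic integrand; and for
  Hermitian \<open>A\<close> the matrix is \<open>2 cos t A\<close>, where the integral of \<open>\<bar>2 cos t\<bar>\<^sup>d\<close> is a Beta value that
  Legendre's duplication formula turns into the normalising constant.
\<close>

section \<open>Symmetric seminorms and doubly stochastic matrices\<close>

lemma sorting_permutation:
  fixes x :: "nat \<Rightarrow> real"
  obtains \<pi> where "\<pi> permutes {..<n}" "\<And>i j. i \<le> j \<Longrightarrow> j < n \<Longrightarrow> x (\<pi> i) \<le> x (\<pi> j)"
proof -
  define xs where "xs = map x [0..<n]"
  have "mset (sort xs) = mset xs" by simp
  then obtain \<pi> where \<pi>: "\<pi> permutes {..<length xs}" "permute_list \<pi> xs = sort xs"
    by (rule mset_eq_permutation)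
  have "sort xs ! i = x (\<pi> i)" if "i < n" for i
  proof -
    have "\<pi> i < n" using permutes_in_image[OF \<pi>(1), of i] that by (simp add: xs_def)
    then show ?thesis
      using that permute_list_nth[OF \<pi>(1), of i, unfolded \<pi>(2)] by (simp add: xs_def)
  qed
  then have "x (\<pi> i) \<le> x (\<pi> j)" if "i \<le> j" "j < n" for i j
    using sorted_nth_mono[OF sorted_sort, of i j xs] that by (simp add: xs_def)
  with \<pi>(1) show ?thesis by (intro that) (auto simp: xs_def)
qed

text \<open>Vectors are total functions on the naturals, so \<open>cong\<close> is what makes
  \<open>F\<close> a function of the first \<open>n\<close> entries only. Definiteness enters
  separately, in \<open>spectral_eq_0_imp\<close>.\<close>

locale symmetric_seminorm =
  fixes n :: nat and F :: "(nat \<Rightarrow> real) \<Rightarrow> real"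
  assumes cong: "(\<And>i. i < n \<Longrightarrow> x i = y i) \<Longrightarrow> F x = F y"
    and permute: "\<pi> permutes {..<n} \<Longrightarrow> F (x \<circ> \<pi>) = F x"
    and triangle: "F (\<lambda>i. x i + y i) \<le> F x + F y"
    and scale: "F (\<lambda>i. c * x i) = \<bar>c\<bar> * F x"
begin

lemma convex:
  assumes "0 \<le> t" "t \<le> 1"
  shows "F (\<lambda>i. (1 - t) * x i + t * y i) \<le> (1 - t) * F x + t * F y"
  using triangle[of "\<lambda>i. (1 - t) * x i" "\<lambda>i. t * y i"] assms by (simp add: scale)

text \<open>
  Hardy, Littlewood and Polya: the smaller vector is reached by transfers between two
  coordinates, each of which makes one more coordinate agree. Only \<open>y\<close> has to be sorted.
\<close>
lemma majorization:
  assumes sorted: "\<And>i j. i \<le> j \<Longrightarrow> j < n \<Longrightarrow> y i \<le> y j"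
    and "\<And>m. m \<le> n \<Longrightarrow> sum x {..<m} \<le> sum y {..<m}"
    and "sum x {..<n} = sum y {..<n}"
  shows "F y \<le> F x"
  using assms(2,3)
proof (induction "card {i. i < n \<and> x i \<noteq> y i}" arbitrary: x rule: less_induct)
  case less
  show ?case
  proof (cases "\<exists>i<n. x i \<noteq> y i")
    case False
    then have "F x = F y" by (intro cong) auto
    then show ?thesis by simp
  next
    case True
    have "\<exists>k<n. y k < x k"
    proof (rule ccontr)
      assume no: "\<not> (\<exists>k<n. y k < x k)"
      from True obtain i where i: "i < n" "x i \<noteq> y i" by blast
      have "sum x {..<n} < sum y {..<n}"
      proof (rule sum_strict_mono_ex1)
        show le: "\<forall>k\<in>{..<n}. x k \<le> y k" using no by (metis lessThan_iff not_less)
        show "\<exists>k\<in>{..<n}. x k < y k" using le i by (intro bexI[of _ i]) (auto simp: less_le)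
      qed simp
      then show False using less.prems(2) by simp
    qed
    \<comment> \<open>\<open>k\<close> is the first coordinate with an excess and \<open>j\<close>
      below is the last coordinate before \<open>k\<close> with a deficit, so \<open>x\<close> and
      \<open>y\<close> agree strictly between them.\<close>
    define k where "k = (LEAST k. k < n \<and> y k < x k)"
    have k: "k < n" "y k < x k" and k_least: "\<And>i. i < k \<Longrightarrow> x i \<le> y i"
      using LeastI_ex[OF \<open>\<exists>k<n. y k < x k\<close>] not_less_Least[of _ "\<lambda>k. k < n \<and> y k < x k"]
      unfolding k_def[symmetric] by force+
    \<comment> \<open>Otherwise \<open>x\<close> and \<open>y\<close> agree before \<open>k\<close>,
      and the prefix of \<open>x\<close> of length \<open>Suc k\<close> would have too large a
      sum.\<close>
    have "\<exists>j<k. x j < y j"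
    proof (rule ccontr)
      assume "\<not> (\<exists>j<k. x j < y j)"
      then have "y i \<le> x i" if "i < k" for i using that by (metis not_less)
      then have "sum x {..<k} = sum y {..<k}"
        using k_least by (intro sum.cong refl antisym) auto
      then show False using less.prems(1)[of "Suc k"] k by simp
    qed
    define j where "j = (GREATEST j. j < k \<and> x j < y j)"
    have j: "j < k" "x j < y j" and "\<And>i. i < k \<Longrightarrow> x i < y i \<Longrightarrow> i \<le> j"
      using GreatestI_ex_nat[OF \<open>\<exists>j<k. x j < y j\<close>, of k]
        Greatest_le_nat[of "\<lambda>j. j < k \<and> x j < y j" _ k]
      unfolding j_def[symmetric] by auto
    then have between: "x i = y i" if "j < i" "i < k" for i
      using k_least[of i] that by force
    \<comment> \<open>The largest transfer from \<open>k\<close> to \<open>j\<close> that overshoots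
      neither target. One of the two coordinates becomes exact, which makes the cardinality
      drop.\<close>
    define e where "e = min (y j - x j) (x k - y k)"
    have e: "0 < e" "e \<le> y j - x j" "e \<le> x k - y k" using j k by (auto simp: e_def)
    \<comment> \<open>The transfer is a convex combination of \<open>x\<close> and of
      \<open>x\<close> with the entries \<open>j\<close> and \<open>k\<close> swapped, and
      \<open>t\<close> is the weight of the latter. As \<open>F\<close> is invariant under the swap,
      the transfer does not increase it. That \<open>y\<close> is sorted gives
      \<open>t \<le> 1\<close>.\<close>
    define t where "t = e / (x k - x j)"
    have "y j \<le> y k" using sorted j k by simp
    then have gap: "e \<le> x k - x j" "0 < x k - x j" using e j by linarith+
    then have t: "0 \<le> t" "t \<le> 1" "t * (x k - x j) = e" using e by (auto simp: t_def)
    define z where "z = (\<lambda>i. x i + (if i = j then e else 0) - (if i = k then e else 0))"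
    have "z = (\<lambda>i. (1 - t) * x i + t * (x \<circ> Transposition.transpose j k) i)"
    proof
      fix i
      show "z i = (1 - t) * x i + t * (x \<circ> Transposition.transpose j k) i"
        using t(3) j(1) by (auto simp: z_def Transposition.transpose_def algebra_simps)
    qed
    then have "F z \<le> (1 - t) * F x + t * F (x \<circ> Transposition.transpose j k)"
      using convex[OF t(1,2), of x "x \<circ> Transposition.transpose j k"] by (simp only:)
    also have "F (x \<circ> Transposition.transpose j k) = F x"
      using j k by (intro permute permutes_swap_id) auto
    finally have z_le: "F z \<le> F x" by (simp add: algebra_simps)
    have sum_z: "sum z {..<m} = sum x {..<m} + (if j < m then e else 0) - (if k < m then e else 0)"
      for m by (simp add: z_def sum.distrib sum_subtractf)
    have "F y \<le> F z"
    proof (rule less.hyps)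
      show "card {i. i < n \<and> z i \<noteq> y i} < card {i. i < n \<and> x i \<noteq> y i}"
      proof (rule psubset_card_mono)
        have "{i. i < n \<and> z i \<noteq> y i} \<subseteq> {i. i < n \<and> x i \<noteq> y i}"
          using j k by (auto simp: z_def split: if_splits)
        moreover have "z j = y j \<or> z k = y k"
          using j k by (auto simp: z_def e_def min_def)
        ultimately show "{i. i < n \<and> z i \<noteq> y i} \<subset> {i. i < n \<and> x i \<noteq> y i}"
          using j k by auto
      qed simp
      show "sum z {..<n} = sum y {..<n}"
        using less.prems(2) j k by (simp add: sum_z)
      show "sum z {..<m} \<le> sum y {..<m}" if "m \<le> n" for m
      \<comment> \<open>Only prefixes that end between \<open>j\<close> and \<open>k\<close> gain
        \<open>e\<close>. Past \<open>j\<close> they agree with those of \<open>y\<close>, and the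
        deficit at \<open>j\<close> is at least \<open>e\<close>.\<close>
      proof (cases "j < m \<and> m \<le> k")
        case True
        have split: "sum f {..<m} = sum f {..<j} + f j + sum f {Suc j..<m}" for f :: "nat \<Rightarrow> real"
          using True
          by (metis lessThan_atLeast0 le0 sum.atLeastLessThan_concat Suc_leI
              sum.lessThan_Suc)
        have "sum x {Suc j..<m} = sum y {Suc j..<m}"
          using True between by (intro sum.cong) auto
        then show ?thesis
          using less.prems(1)[of j] True e that split[of x] split[of y] by (simp add: sum_z)
      next
        case False
        then show ?thesis using less.prems(1)[of m] that j by (auto simp: sum_z)
      qed
    qed
    with z_le show ?thesis by simp
  qed
qed

text \<open>With both vectors in ascending order, the sum of the \<open>m\<close> smallest entries
  of the image is a combination of the entries of \<open>x\<close> whose weights lie in [0, 1] and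
  add up to \<open>m\<close>. It is thus at least the sum of the \<open>m\<close> smallest entries
  of \<open>x\<close>, and \<open>majorization\<close> applies with the image as the smaller
  vector.\<close>

lemma doubly_stochastic:
  fixes S :: "nat \<Rightarrow> nat \<Rightarrow> real"
  assumes nonneg: "\<And>i j. i < n \<Longrightarrow> j < n \<Longrightarrow> 0 \<le> S i j"
    and rows: "\<And>i. i < n \<Longrightarrow> (\<Sum>j<n. S i j) = 1"
    and cols: "\<And>j. j < n \<Longrightarrow> (\<Sum>i<n. S i j) = 1"
  shows "F (\<lambda>i. \<Sum>j<n. S i j * x j) \<le> F x"
proof -
  define y where "y = (\<lambda>i. \<Sum>j<n. S i j * x j)"
  obtain \<sigma> where \<sigma>: "\<sigma> permutes {..<n}"
    and y_sorted: "\<And>i j. i \<le> j \<Longrightarrow> j < n \<Longrightarrow> y (\<sigma> i) \<le> y (\<sigma> j)"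
    using sorting_permutation[of n y] by blast
  obtain \<pi> where \<pi>: "\<pi> permutes {..<n}"
    and x_sorted: "\<And>i j. i \<le> j \<Longrightarrow> j < n \<Longrightarrow> x (\<pi> i) \<le> x (\<pi> j)"
    using sorting_permutation[of n x] by blast
  have \<sigma>_less: "\<sigma> i < n" if "i < n" for i using permutes_in_image[OF \<sigma>, of i] that by simp
  have \<pi>_less: "\<pi> i < n" if "i < n" for i using permutes_in_image[OF \<pi>, of i] that by simp
  \<comment> \<open>\<open>T\<close> is \<open>S\<close> rearranged to fit the two sorted vectors;
    \<open>c m j\<close> is the weight of the entry \<open>x (\<pi> j)\<close> in the sum of the
    first \<open>m\<close> sorted entries of \<open>y\<close>.\<close>
  define T where "T = (\<lambda>i j. S (\<sigma> i) (\<pi> j))"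
  define c where "c = (\<lambda>m j. \<Sum>i<m. T i j)"
  have T_nonneg: "0 \<le> T i j" if "i < n" "j < n" for i j
    using that nonneg \<sigma>_less \<pi>_less by (simp add: T_def)
  have T_rows: "(\<Sum>j<n. T i j) = 1" if "i < n" for i
    using sum.permute[OF \<pi>, of "S (\<sigma> i)"] rows[OF \<sigma>_less[OF that]] by (simp add: T_def comp_def)
  have T_cols: "(\<Sum>i<n. T i j) = 1" if "j < n" for j
    using sum.permute[OF \<sigma>, of "\<lambda>i. S i (\<pi> j)"] cols[OF \<pi>_less[OF that]]
    by (simp add: T_def comp_def)
  have sum_y: "(\<Sum>i<m. y (\<sigma> i)) = (\<Sum>j<n. c m j * x (\<pi> j))" for m
  proof -
    have "y (\<sigma> i) = (\<Sum>j<n. T i j * x (\<pi> j))" for i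
      using sum.permute[OF \<pi>, of "\<lambda>j. S (\<sigma> i) j * x j"] by (simp add: T_def y_def comp_def)
    then have "(\<Sum>i<m. y (\<sigma> i)) = (\<Sum>j<n. \<Sum>i<m. T i j * x (\<pi> j))"
      by (simp add: sum.swap[of _ "{..<n}"])
    then show ?thesis by (simp add: c_def sum_distrib_right)
  qed
  have "F (y \<circ> \<sigma>) \<le> F (x \<circ> \<pi>)"
  proof (rule majorization)
    show "(y \<circ> \<sigma>) i \<le> (y \<circ> \<sigma>) j" if "i \<le> j" "j < n" for i j
      using y_sorted[OF that] by simp
    have "c n j = 1" if "j < n" for j using T_cols that by (simp add: c_def)
    then show "sum (x \<circ> \<pi>) {..<n} = sum (y \<circ> \<sigma>) {..<n}" by (simp add: sum_y)
    show "sum (x \<circ> \<pi>) {..<m} \<le> sum (y \<circ> \<sigma>) {..<m}" if m: "m \<le> n" for m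
    proof (cases m)
      case (Suc m')
      \<comment> \<open>A pivot: \<open>p\<close> is the largest of the \<open>m\<close> smallest
        entries of \<open>x\<close>. Then \<open>c m j - b j\<close> and
        \<open>x (\<pi> j) - p\<close> never have opposite signs, and \<open>p\<close> drops out of
        the sum because both families of weights have total \<open>m\<close>.\<close>
      define p where "p = x (\<pi> m')"
      define b where "b = (\<lambda>j. if j < m then 1 else 0 :: real)"
      have m_set: "{..<n} \<inter> {j. j < m} = {..<m}" using m by auto
      have sum_b: "(\<Sum>j<n. b j * f j) = (\<Sum>j<m. f j)" for f
        using m_set by (simp add: b_def sum.If_cases if_distrib[of "\<lambda>u. u * _"] cong: if_cong)
      have sum_c: "(\<Sum>j<n. c m j) = real m"
        unfolding c_def by (subst sum.swap) (use T_rows m in simp)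
      have c_le: "c m j \<le> 1" if "j < n" for j
      proof -
        have "c m j \<le> (\<Sum>i<n. T i j)"
          unfolding c_def using m that T_nonneg by (intro sum_mono2) auto
        then show ?thesis using T_cols[OF that] by simp
      qed
      have c_nonneg: "0 \<le> c m j" if "j < n" for j
        unfolding c_def using m that T_nonneg by (intro sum_nonneg) auto
      have "0 \<le> (\<Sum>j<n. (c m j - b j) * (x (\<pi> j) - p))"
      proof (rule sum_nonneg)
        fix j assume "j \<in> {..<n}"
        then have j: "j < n" by simp
        show "0 \<le> (c m j - b j) * (x (\<pi> j) - p)"
        proof (cases "j < m")
          case True
          then have "x (\<pi> j) \<le> p" using x_sorted[of j m'] Suc m by (simp add: p_def)
          then show ?thesis using c_le[OF j] True by (simp add: b_def mult_nonpos_nonpos)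
        next
          case False
          then have "p \<le> x (\<pi> j)" using x_sorted[of m' j] Suc j by (simp add: p_def)
          then show ?thesis using c_nonneg[OF j] False by (simp add: b_def)
        qed
      qed
      also have "\<dots> = (\<Sum>j<n. c m j * x (\<pi> j)) - (\<Sum>j<n. b j * x (\<pi> j))
          - ((\<Sum>j<n. c m j) - (\<Sum>j<n. b j * 1)) * p"
        by (simp add: algebra_simps sum.distrib sum_subtractf sum_distrib_left)
      also have "\<dots> = (\<Sum>i<m. y (\<sigma> i)) - (\<Sum>j<m. x (\<pi> j))"
        unfolding sum_b sum_c sum_y by simp
      finally show ?thesis by simp
    qed simp
  qed
  then show ?thesis using permute[OF \<sigma>] permute[OF \<pi>] by (simp add: y_def)
qed

end

section \<open>Unitary diagonalization of Hermitian matrices\<close>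

lemma dim_mat_adjoint [simp]:
  "dim_row (mat_adjoint A) = dim_col A" "dim_col (mat_adjoint A) = dim_row A"
  by (auto simp: mat_adjoint_def)

lemma index_mat_adjoint [simp]:
  assumes "i < dim_col A" "j < dim_row A"
  shows "mat_adjoint A $$ (i, j) = conjugate (A $$ (j, i))"
  using assms by (simp add: mat_adjoint_def mat_of_rows_index)

lemma carrier_mat_adjoint [simp]: "A \<in> carrier_mat m n \<Longrightarrow> mat_adjoint A \<in> carrier_mat n m"
  by (intro carrier_matI) auto

lemma index_mult_mat_sum:
  assumes "A \<in> carrier_mat m n" "B \<in> carrier_mat n k" "i < m" "j < k"
  shows "(A * B) $$ (i, j) = (\<Sum>l<n. A $$ (i, l) * B $$ (l, j))"
  using assms by (auto simp: Matrix.scalar_prod_def lessThan_atLeast0)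

lemma mat_adjoint_mult:
  fixes A B :: "complex mat"
  assumes "A \<in> carrier_mat m n" "B \<in> carrier_mat n k"
  shows "mat_adjoint (A * B) = mat_adjoint B * mat_adjoint A"
proof (rule eq_matI)
  fix i j assume "i < dim_row (mat_adjoint B * mat_adjoint A)"
    "j < dim_col (mat_adjoint B * mat_adjoint A)"
  then have ij: "i < k" "j < m" using assms by auto
  have "mat_adjoint (A * B) $$ (i, j) = cnj ((A * B) $$ (j, i))" using assms ij by simp
  also have "\<dots> = (\<Sum>l<n. cnj (A $$ (j, l) * B $$ (l, i)))"
    using ij by (simp only: index_mult_mat_sum[OF assms] cnj_sum)
  also have "\<dots> = (mat_adjoint B * mat_adjoint A) $$ (i, j)"
    using assms ij
    by (subst index_mult_mat_sum[of _ k n _ m]) (auto intro!: sum.cong simp: mult.commute)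
  finally show "mat_adjoint (A * B) $$ (i, j) = (mat_adjoint B * mat_adjoint A) $$ (i, j)" .
qed (use assms in auto)

lemma mat_adjoint_adjoint [simp]: "mat_adjoint (mat_adjoint A) = (A :: complex mat)"
  by (rule eq_matI) auto

definition unitary_mat :: "nat \<Rightarrow> complex mat \<Rightarrow> bool" where
  "unitary_mat n U \<longleftrightarrow> U \<in> carrier_mat n n \<and> mat_adjoint U * U = 1\<^sub>m n"

definition real_diag_mat :: "nat \<Rightarrow> (nat \<Rightarrow> real) \<Rightarrow> complex mat" where
  "real_diag_mat n l = mat n n (\<lambda>(i, j). if i = j then complex_of_real (l i) else 0)"

lemma real_diag_mat_carrier [simp]: "real_diag_mat n l \<in> carrier_mat n n"
  by (simp add: real_diag_mat_def)

lemma dim_real_diag_mat [simp]: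
  "dim_row (real_diag_mat n l) = n" "dim_col (real_diag_mat n l) = n"
  by (simp_all add: real_diag_mat_def)

lemma unitary_mat_carrier: "unitary_mat n U \<Longrightarrow> U \<in> carrier_mat n n"
  by (simp add: unitary_mat_def)

lemma unitary_mat_left: "unitary_mat n U \<Longrightarrow> mat_adjoint U * U = 1\<^sub>m n"
  by (simp add: unitary_mat_def)

lemma unitary_mat_right: "unitary_mat n U \<Longrightarrow> U * mat_adjoint U = 1\<^sub>m n"
  using mat_mult_left_right_inverse[of "mat_adjoint U" n U] by (simp add: unitary_mat_def)

lemma unitary_mat_adjoint: "unitary_mat n U \<Longrightarrow> unitary_mat n (mat_adjoint U)"
  using unitary_mat_right by (auto simp: unitary_mat_def)

lemma unitary_mat_cancel:
  assumes "unitary_mat n U" "V \<in> carrier_mat n k"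
  shows "mat_adjoint U * (U * V) = V" "U * (mat_adjoint U * V) = V"
  using assms unitary_mat_left[of n U] unitary_mat_right[of n U] unitary_mat_carrier[of n U]
    assoc_mult_mat[of "mat_adjoint U" n n U n V k] assoc_mult_mat[of U n n "mat_adjoint U" n V k]
  by auto

lemma unitary_mat_mult:
  assumes U: "unitary_mat n U" and V: "unitary_mat n V"
  shows "unitary_mat n (U * V)"
proof -
  note c = unitary_mat_carrier[OF U] unitary_mat_carrier[OF V]
  have "mat_adjoint (U * V) * (U * V) = mat_adjoint V * (mat_adjoint U * (U * V))"
    using c by (simp add: mat_adjoint_mult[of _ n n _ n]
        assoc_mult_mat[of "mat_adjoint V" n n "mat_adjoint U" n _ n])
  then show ?thesis
    using c U by (simp add: unitary_mat_def unitary_mat_cancel unitary_mat_left[OF V])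
qed

text \<open>Successive changes of orthonormal basis compose. The inductive diagonalization and
  Schur's inequality both rest on this.\<close>

lemma unitary_conj_mult:
  assumes "unitary_mat n U" "unitary_mat n W" "D \<in> carrier_mat n n"
  shows "U * (W * D * mat_adjoint W) * mat_adjoint U = (U * W) * D * mat_adjoint (U * W)"
proof -
  note c = unitary_mat_carrier[OF assms(1)] unitary_mat_carrier[OF assms(2)] assms(3)
  then have m: "X * Y \<in> carrier_mat n n" if "X \<in> carrier_mat n n" "Y \<in> carrier_mat n n"
    for X Y :: "complex mat" using that by simp
  show ?thesis
    using c by (simp add: mat_adjoint_mult[of _ n n _ n] assoc_mult_mat[of _ n n _ n _ n] m
        del: assoc_mult_mat)
qed

text \<open>An eigenvector is completed to a basis. Gram-Schmidt keeps the first vector and makes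
  the family orthogonal; dividing each vector by its length \<open>r j\<close> gives the
  columns.\<close>

lemma unitary_mat_exists_eigen_col:
  fixes A :: "complex mat"
  assumes A: "A \<in> carrier_mat n n" and e: "eigenvalue A e"
  obtains U where "unitary_mat n U" "A *\<^sub>v Matrix.col U 0 = e \<cdot>\<^sub>v Matrix.col U 0"
proof -
  from e A obtain v where v: "v \<in> carrier_vec n" "v \<noteq> 0\<^sub>v n" "A *\<^sub>v v = e \<cdot>\<^sub>v v"
    by (auto simp: eigenvalue_def eigenvector_def)
  have n: "n \<noteq> 0" using v by (metis carrier_vecD eq_vecI index_zero_vec(2) not_less0)
  interpret cof_vec_space n "TYPE(complex)" .
  define b where "b = basis_completion v"
  define ws where "ws = gram_schmidt n b"
  from basis_completion[OF v(1,2), folded b_def]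
  have dist_b: "distinct b" and indep: "\<not> lin_dep (set b)" and b: "set b \<subseteq> carrier_vec n"
    and hdb: "hd b = v" and len_b: "length b = n" by auto
  from hdb len_b n obtain vs where bv: "b = v # vs" by (cases b) auto
  from gram_schmidt_result[OF b dist_b indep refl, folded ws_def]
  have ws: "set ws \<subseteq> carrier_vec n" "corthogonal ws" "length ws = n"
    by (auto simp: len_b)
  from gram_schmidt_hd[OF v(1), of vs, folded bv] have "hd ws = v" unfolding ws_def .
  then have ws0: "ws ! 0 = v" using ws(3) n hd_conv_nth[of ws] by auto
  have ws_dim: "dim_vec (ws ! i) = n" if "i < n" for i
    using ws that by (metis carrier_vecD nth_mem subsetD)
  define r where "r = (\<lambda>i. sqrt (\<Sum>k<n. (cmod (vec_index (ws ! i) k))\<^sup>2))"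
  define U where "U = mat n n (\<lambda>(i, j). vec_index (ws ! j) i / complex_of_real (r j))"
  have sprod: "ws ! i \<bullet>c ws ! j = (\<Sum>k<n. vec_index (ws ! i) k * cnj (vec_index (ws ! j) k))"
    if "i < n" "j < n" for i j
    using that by (auto simp: Matrix.scalar_prod_def ws_dim lessThan_atLeast0 intro!: sum.cong)
  have r2: "complex_of_real (r i) * complex_of_real (r i) = ws ! i \<bullet>c ws ! i" if "i < n" for i
  proof -
    have "r i * r i = (\<Sum>k<n. (cmod (vec_index (ws ! i) k))\<^sup>2)"
      unfolding r_def by (simp add: sum_nonneg)
    then show ?thesis
      unfolding sprod[OF that that] of_real_mult[symmetric]
      by (simp add: complex_norm_square[symmetric])
  qed
  have r0: "r i \<noteq> 0" if "i < n" for i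
    using r2[OF that] corthogonalD[OF ws(2), of i i] that ws(3) by auto
  have U: "U \<in> carrier_mat n n" by (simp add: U_def)
  have "mat_adjoint U * U = 1\<^sub>m n"
  proof (rule eq_matI)
    fix i j assume "i < dim_row (1\<^sub>m n :: complex mat)" "j < dim_col (1\<^sub>m n :: complex mat)"
    then have ij: "i < n" "j < n" by auto
    have "(mat_adjoint U * U) $$ (i, j) = (\<Sum>k<n. cnj (U $$ (k, i)) * U $$ (k, j))"
      using U ij by (subst index_mult_mat_sum[of _ n n _ n]) auto
    also have "\<dots> = (\<Sum>k<n. vec_index (ws ! j) k * cnj (vec_index (ws ! i) k) / (r j * r i))"
      using ij by (intro sum.cong) (auto simp: U_def field_simps)
    also have "\<dots> = (ws ! j \<bullet>c ws ! i) / (r j * r i)"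
      using ij by (simp add: sprod sum_divide_distrib)
    also have "\<dots> = (1\<^sub>m n :: complex mat) $$ (i, j)"
      using corthogonalD[OF ws(2), of j i] ij ws(3) r2[of i] r0[of i] by auto
    finally show "(mat_adjoint U * U) $$ (i, j) = (1\<^sub>m n :: complex mat) $$ (i, j)" .
  qed (use U in auto)
  with U have unitary: "unitary_mat n U" by (simp add: unitary_mat_def)
  have "Matrix.col U 0 = (1 / complex_of_real (r 0)) \<cdot>\<^sub>v v"
    using n ws_dim[of 0] by (intro eq_vecI) (auto simp: U_def ws0)
  then have "A *\<^sub>v Matrix.col U 0 = e \<cdot>\<^sub>v Matrix.col U 0"
    using v A by (simp add: mult_mat_vec smult_smult_assoc mult.commute)
  with unitary show ?thesis by (rule that)
qed

lemma eigenvalue_exists: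
  fixes A :: "complex mat"
  assumes A: "A \<in> carrier_mat n n" and "n > 0"
  obtains e where "eigenvalue A e"
proof -
  have "\<not> constant (poly (char_poly A))"
    using degree_monic_char_poly[OF A] \<open>n > 0\<close> by (simp add: constant_degree)
  then show ?thesis
    using fundamental_theorem_of_algebra eigenvalue_root_char_poly[OF A] that by blast
qed

lemma mat_adjoint_four_block:
  fixes A B C D :: "complex mat"
  assumes "A \<in> carrier_mat k k" "B \<in> carrier_mat k m" "C \<in> carrier_mat m k" "D \<in> carrier_mat m m"
  shows "mat_adjoint (four_block_mat A B C D) =
    four_block_mat (mat_adjoint A) (mat_adjoint C) (mat_adjoint B) (mat_adjoint D)"
  using assms by (intro eq_matI) auto

lemma mat_adjoint_one [simp]: "mat_adjoint (1\<^sub>m n) = (1\<^sub>m n :: complex mat)"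
  by (rule eq_matI) auto

lemma mat_adjoint_zero [simp]: "mat_adjoint (0\<^sub>m m n) = (0\<^sub>m n m :: complex mat)"
  by (rule eq_matI) auto

text \<open>Induction on the dimension. In an orthonormal basis that starts with an eigenvector the
  first column vanishes below the diagonal; by symmetry the first row does too, and the remaining
  block is Hermitian of size one less.\<close>

theorem hermitian_diagonalization:
  assumes "A \<in> hermitian_mats n"
  obtains U l where "unitary_mat n U" "A = U * real_diag_mat n l * mat_adjoint U"
proof -
  have "\<exists>U l. unitary_mat n U \<and> A = U * real_diag_mat n l * mat_adjoint U"
    using assms
  proof (induction n arbitrary: A)
    case 0
    then show ?case
      by (intro exI[of _ "1\<^sub>m 0"]) (auto simp: hermitian_mats_def unitary_mat_def intro!: eq_matI)
  next
    case (Suc n)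
    then have A: "A \<in> carrier_mat (Suc n) (Suc n)" "mat_adjoint A = A"
      by (auto simp: hermitian_mats_def)
    obtain e where "eigenvalue A e" using eigenvalue_exists[OF A(1)] by blast
    then obtain U where U: "unitary_mat (Suc n) U"
      and eig: "A *\<^sub>v Matrix.col U 0 = e \<cdot>\<^sub>v Matrix.col U 0"
      using unitary_mat_exists_eigen_col[OF A(1)] by blast
    note Uc = unitary_mat_carrier[OF U]
    define B where "B = mat_adjoint U * (A * U)"
    have AU: "A * U \<in> carrier_mat (Suc n) (Suc n)" using A Uc by simp
    have B: "B \<in> carrier_mat (Suc n) (Suc n)"
      unfolding B_def using AU Uc mult_carrier_mat[of "mat_adjoint U" "Suc n" "Suc n"] by simp
    have B_adj: "mat_adjoint B = B"
      using A Uc by (simp add: B_def mat_adjoint_mult[of _ "Suc n" "Suc n" _ "Suc n"]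
          assoc_mult_mat[of _ "Suc n" "Suc n" _ "Suc n" _ "Suc n"])
    have B_cnj: "B $$ (i, j) = cnj (B $$ (j, i))" if "i < Suc n" "j < Suc n" for i j
      using B that by (subst B_adj[symmetric]) simp
    have B0: "B $$ (i, 0) = (if i = 0 then e else 0)" if "i < Suc n" for i
    proof -
      have "B $$ (i, 0) = Matrix.scalar_prod (Matrix.row (mat_adjoint U) i) (Matrix.col (A * U) 0)"
        using that A Uc by (simp add: B_def)
      also have "Matrix.col (A * U) 0 = e \<cdot>\<^sub>v Matrix.col U 0"
        using A Uc eig by (subst col_mult2[of _ "Suc n" "Suc n" _ "Suc n"]) auto
      also have "Matrix.scalar_prod (Matrix.row (mat_adjoint U) i) (e \<cdot>\<^sub>v Matrix.col U 0)
          = e * (mat_adjoint U * U) $$ (i, 0)"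
      proof -
        have "Matrix.row (mat_adjoint U) i \<in> carrier_vec (Suc n)"
          "Matrix.col U 0 \<in> carrier_vec (Suc n)"
          using Uc by (auto intro!: carrier_vecI)
        then show ?thesis using that Uc by (simp add: scalar_prod_smult_distrib[of _ "Suc n"])
      qed
      finally show ?thesis using that by (simp add: unitary_mat_left[OF U])
    qed
    define C where "C = mat n n (\<lambda>(i, j). B $$ (Suc i, Suc j))"
    have C: "C \<in> carrier_mat n n" by (simp add: C_def)
    have "C \<in> hermitian_mats n"
      by (auto simp: hermitian_mats_def C_def B_cnj[symmetric] intro!: eq_matI)
    then obtain V m where V: "unitary_mat n V" and CV: "C = V * real_diag_mat n m * mat_adjoint V"
      using Suc.IH by blast
    note Vc = unitary_mat_carrier[OF V]
    \<comment> \<open>\<open>Re e\<close> loses nothing: \<open>e\<close> is a diagonal entry of the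
      Hermitian matrix \<open>B\<close> and hence real.\<close>
    define l where "l = (\<lambda>i. case i of 0 \<Rightarrow> Re e | Suc i \<Rightarrow> m i)"
    have e_real: "complex_of_real (Re e) = e"
      using B_cnj[of 0 0] unfolding B0[OF zero_less_Suc] by (simp add: complex_eq_iff)
    have B0': "B $$ (0, j) = (if j = 0 then e else 0)" if "j < Suc n" for j
    proof -
      have "B $$ (0, j) = cnj (B $$ (j, 0))" using that by (intro B_cnj) auto
      also have "\<dots> = cnj (if j = 0 then e else 0)" by (simp only: B0[OF that])
      also have "\<dots> = (if j = 0 then e else 0)"
        using e_real by (metis complex_cnj_complex_of_real complex_cnj_zero)
      finally show ?thesis .
    qed
    have B_block: "B = four_block_mat (real_diag_mat 1 l) (0\<^sub>m 1 n) (0\<^sub>m n 1) C"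
    proof (rule eq_matI)
      fix i j assume "i < dim_row (four_block_mat (real_diag_mat 1 l) (0\<^sub>m 1 n) (0\<^sub>m n 1) C)"
        "j < dim_col (four_block_mat (real_diag_mat 1 l) (0\<^sub>m 1 n) (0\<^sub>m n 1) C)"
      then have ij: "i < Suc n" "j < Suc n" using C by auto
      then show "B $$ (i, j) = four_block_mat (real_diag_mat 1 l) (0\<^sub>m 1 n) (0\<^sub>m n 1) C $$ (i, j)"
        using B0[of i] B0'[of j] e_real C
        by (cases i; cases j) (auto simp: real_diag_mat_def C_def l_def)
    qed (use B C in auto)
    have diag_block: "real_diag_mat (Suc n) l
        = four_block_mat (real_diag_mat 1 l) (0\<^sub>m 1 n) (0\<^sub>m n 1) (real_diag_mat n m)"
    proof (rule eq_matI)
      fix i j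
      assume "i < dim_row (four_block_mat (real_diag_mat 1 l) (0\<^sub>m 1 n) (0\<^sub>m n 1) (real_diag_mat n m))"
        "j < dim_col (four_block_mat (real_diag_mat 1 l) (0\<^sub>m 1 n) (0\<^sub>m n 1) (real_diag_mat n m))"
      then have "i < Suc n" "j < Suc n" by (auto simp: real_diag_mat_def)
      then show "real_diag_mat (Suc n) l $$ (i, j)
          = four_block_mat (real_diag_mat 1 l) (0\<^sub>m 1 n) (0\<^sub>m n 1) (real_diag_mat n m) $$ (i, j)"
        by (cases i; cases j) (auto simp: real_diag_mat_def l_def)
    qed (auto simp: real_diag_mat_def)
    \<comment> \<open>\<open>W\<close> fixes the eigenvector and diagonalizes the remaining block,
      so \<open>U * W\<close> diagonalizes \<open>A\<close>.\<close>
    define W where "W = four_block_mat (1\<^sub>m 1) (0\<^sub>m 1 n) (0\<^sub>m n 1) V"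
    have W_adj: "mat_adjoint W = four_block_mat (1\<^sub>m 1) (0\<^sub>m 1 n) (0\<^sub>m n 1) (mat_adjoint V)"
      unfolding W_def using Vc by (subst mat_adjoint_four_block[of _ 1 _ n]) auto
    have Wc: "W \<in> carrier_mat (Suc n) (Suc n)"
      using Vc four_block_carrier_mat[of "1\<^sub>m 1" 1 1 V n n] by (simp add: W_def)
    have W: "unitary_mat (Suc n) W"
      unfolding unitary_mat_def
    proof
      have "mat_adjoint W * W = four_block_mat (1\<^sub>m 1) (0\<^sub>m 1 n) (0\<^sub>m n 1) (1\<^sub>m n)"
        unfolding W_adj unfolding W_def using Vc unitary_mat_left[OF V]
        by (subst mult_four_block_mat[of _ 1 1 _ n _ n _ _ 1 _ n]) auto
      then show "mat_adjoint W * W = 1\<^sub>m (Suc n)" by simp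
    qed (rule Wc)
    have VD: "V * real_diag_mat n m \<in> carrier_mat n n" using Vc by simp
    have "W * real_diag_mat (Suc n) l
        = four_block_mat (real_diag_mat 1 l) (0\<^sub>m 1 n) (0\<^sub>m n 1) (V * real_diag_mat n m)"
      unfolding W_def diag_block
      using Vc by (subst mult_four_block_mat[of _ 1 1 _ n _ n _ _ 1 _ n]) auto
    then have "B = W * real_diag_mat (Suc n) l * mat_adjoint W"
      unfolding B_block CV W_adj
      using Vc VD by (simp only:, subst mult_four_block_mat[of _ 1 1 _ n _ n _ _ 1 _ n]) auto
    moreover have "A = U * B * mat_adjoint U"
    proof -
      have "U * B = A * U" unfolding B_def by (rule unitary_mat_cancel[OF U AU])
      also have "\<dots> * mat_adjoint U = A * (U * mat_adjoint U)"
        using A Uc by (intro assoc_mult_mat) auto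
      finally show ?thesis using A by (simp add: unitary_mat_right[OF U])
    qed
    ultimately have "A = U * (W * real_diag_mat (Suc n) l * mat_adjoint W) * mat_adjoint U"
      by simp
    also have "\<dots> = (U * W) * real_diag_mat (Suc n) l * mat_adjoint (U * W)"
      by (rule unitary_conj_mult[OF U W]) simp
    finally show ?case using unitary_mat_mult[OF U W] by blast
  qed
  then show ?thesis using that by blast
qed

text \<open>Similar matrices have the same characteristic polynomial, and that of a diagonal matrix
  is the product of the linear factors of its entries. So the sorted list of eigenvalues has the
  same multiset as \<open>l\<close>.\<close>

lemma hermitian_eigvals_permutation:
  assumes U: "unitary_mat n U"
  obtains \<pi> where "\<pi> permutes {..<n}"
    "\<And>i. i < n \<Longrightarrow> hermitian_eigvals (U * real_diag_mat n l * mat_adjoint U) ! i = l (\<pi> i)"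
proof -
  define A where "A = U * real_diag_mat n l * mat_adjoint U"
  note Uc = unitary_mat_carrier[OF U]
  have "similar_mat_wit A (real_diag_mat n l) U (mat_adjoint U)"
    using Uc unitary_mat_left[OF U] unitary_mat_right[OF U]
    by (intro similar_mat_witI[of _ _ n]) (auto simp: A_def)
  then have "char_poly A = char_poly (real_diag_mat n l)"
    by (intro char_poly_similar) (auto simp: similar_mat_def)
  also have "\<dots> = (\<Prod>a\<leftarrow>diag_mat (real_diag_mat n l). [:- a, 1:])"
    by (rule char_poly_upper_triangular[of _ n]) (auto simp: real_diag_mat_def)
  also have "diag_mat (real_diag_mat n l) = map (\<lambda>i. complex_of_real (l i)) [0..<n]"
    by (auto simp: diag_mat_def real_diag_mat_def)
  finally have "char_poly A = (\<Prod>a\<leftarrow>map (\<lambda>i. complex_of_real (l i)) [0..<n]. [:- a, 1:])" .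
  also have "proots \<dots> = mset (map (\<lambda>i. complex_of_real (l i)) [0..<n])"
  proof -
    have "proots (\<Prod>a\<leftarrow>as. [:- a, 1:]) = mset as" for as :: "complex list"
    proof (induction as)
      case (Cons a as)
      have "(\<Prod>a\<leftarrow>as. [:- a, 1:]) \<noteq> 0" by (auto simp: prod_list_zero_iff)
      then show ?case using Cons by (simp add: proots_mult del: mult_pCons_left)
    qed simp
    then show ?thesis .
  qed
  finally have "proots (char_poly A) = mset (map (\<lambda>i. complex_of_real (l i)) [0..<n])" .
  then have "image_mset Re (proots (char_poly A)) = mset (map l [0..<n])"
    by (simp add: image_mset.compositionality comp_def)
  then have "mset (hermitian_eigvals A) = mset (map l [0..<n])"
    by (simp add: hermitian_eigvals_def)
  then obtain \<pi> where \<pi>: "\<pi> permutes {..<length (map l [0..<n])}"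
    "permute_list \<pi> (map l [0..<n]) = hermitian_eigvals A"
    by (rule mset_eq_permutation)
  show ?thesis
  proof
    show perm: "\<pi> permutes {..<n}" using \<pi>(1) by simp
    fix i assume i: "i < n"
    then have "\<pi> i < n" using permutes_in_image[OF perm, of i] by simp
    then show "hermitian_eigvals (U * real_diag_mat n l * mat_adjoint U) ! i = l (\<pi> i)"
      using i \<pi> by (simp add: A_def[symmetric] \<pi>(2)[symmetric] permute_list_nth del: \<pi>(2))
  qed
qed

section \<open>Diagonals of Hermitian matrices and squared moduli of unitary entries\<close>

lemma diag_conjugated_real_diag:
  assumes "U \<in> carrier_mat n n" "i < n"
  shows "(U * real_diag_mat n l * mat_adjoint U) $$ (i, i)
    = complex_of_real (\<Sum>j<n. (cmod (U $$ (i, j)))\<^sup>2 * l j)"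
proof -
  have "(U * real_diag_mat n l) $$ (i, j) = U $$ (i, j) * l j" if "j < n" for j
  proof -
    have "(U * real_diag_mat n l) $$ (i, j)
        = (\<Sum>k<n. if k = j then U $$ (i, j) * complex_of_real (l j) else 0)"
      using assms that
      by (subst index_mult_mat_sum[of _ n n _ n])
        (auto simp: real_diag_mat_def if_distrib[of "\<lambda>x. _ * x"] cong: if_cong)
    then show ?thesis using that by simp
  qed
  then have "(U * real_diag_mat n l * mat_adjoint U) $$ (i, i)
      = (\<Sum>j<n. U $$ (i, j) * complex_of_real (l j) * cnj (U $$ (i, j)))"
    using assms by (subst index_mult_mat_sum[of _ n n _ n]) auto
  also have "\<dots> = (\<Sum>j<n. complex_of_real ((cmod (U $$ (i, j)))\<^sup>2 * l j))"
    by (intro sum.cong) (auto simp: complex_norm_square mult_ac simp del: of_real_power)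
  finally show ?thesis by simp
qed

text \<open>The sum is a diagonal entry of \<open>U * mat_adjoint U\<close>. The column version
  follows by passing to the adjoint.\<close>

lemma unitary_mat_row_sum:
  assumes U: "unitary_mat n U" and i: "i < n"
  shows "(\<Sum>j<n. (cmod (U $$ (i, j)))\<^sup>2) = 1"
proof -
  note Uc = unitary_mat_carrier[OF U]
  have "complex_of_real (\<Sum>j<n. (cmod (U $$ (i, j)))\<^sup>2) = (\<Sum>j<n. U $$ (i, j) * cnj (U $$ (i, j)))"
    by (simp add: complex_norm_square del: of_real_power)
  also have "\<dots> = (U * mat_adjoint U) $$ (i, i)"
    using Uc i by (subst index_mult_mat_sum[of _ n n _ n]) auto
  also have "\<dots> = complex_of_real 1" using i by (simp add: unitary_mat_right[OF U])
  finally show ?thesis by (simp only: of_real_eq_iff)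
qed

lemma unitary_mat_col_sum:
  assumes U: "unitary_mat n U" and j: "j < n"
  shows "(\<Sum>i<n. (cmod (U $$ (i, j)))\<^sup>2) = 1"
  using unitary_mat_row_sum[OF unitary_mat_adjoint[OF U] j] unitary_mat_carrier[OF U] j by simp

lemma hermitian_mats_carrier: "A \<in> hermitian_mats n \<Longrightarrow> A \<in> carrier_mat n n"
  by (simp add: hermitian_mats_def)

lemma hermitian_mats_index:
  "A \<in> hermitian_mats n \<Longrightarrow> i < n \<Longrightarrow> j < n \<Longrightarrow> cnj (A $$ (i, j)) = A $$ (j, i)"
  unfolding hermitian_mats_def using index_mat_adjoint[of j A i] by auto

lemma hermitian_matsI:
  fixes A :: "complex mat"
  assumes "A \<in> carrier_mat n n" "\<And>i j. i < n \<Longrightarrow> j < n \<Longrightarrow> cnj (A $$ (j, i)) = A $$ (i, j)"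
  shows "A \<in> hermitian_mats n"
  unfolding hermitian_mats_def using assms by (auto intro!: eq_matI)

lemma hermitian_mats_add:
  assumes A: "A \<in> hermitian_mats n" and B: "B \<in> hermitian_mats n"
  shows "A + B \<in> hermitian_mats n"
  using hermitian_mats_carrier[OF A] hermitian_mats_carrier[OF B]
    hermitian_mats_index[OF A] hermitian_mats_index[OF B]
  by (intro hermitian_matsI) auto

lemma hermitian_mats_smult:
  assumes A: "A \<in> hermitian_mats n"
  shows "complex_of_real c \<cdot>\<^sub>m A \<in> hermitian_mats n"
  using hermitian_mats_carrier[OF A] hermitian_mats_index[OF A]
  by (intro hermitian_matsI) auto

section \<open>Symmetric seminorms of the spectrum\<close>

context symmetric_seminorm
begin

definition spectral :: "complex mat \<Rightarrow> real" where
  "spectral A = F (\<lambda>i. hermitian_eigvals A ! i)"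

text \<open>\<open>F\<close> ignores the order of the eigenvalues, so any diagonalization may be
  used to compute \<open>spectral\<close>.\<close>

lemma spectral_diag:
  assumes "unitary_mat n U"
  shows "spectral (U * real_diag_mat n l * mat_adjoint U) = F l"
proof -
  obtain \<pi> where \<pi>: "\<pi> permutes {..<n}"
    "\<And>i. i < n \<Longrightarrow> hermitian_eigvals (U * real_diag_mat n l * mat_adjoint U) ! i = l (\<pi> i)"
    using hermitian_eigvals_permutation[OF assms] by metis
  then have "spectral (U * real_diag_mat n l * mat_adjoint U) = F (l \<circ> \<pi>)"
    unfolding spectral_def by (intro cong) auto
  then show ?thesis using permute[OF \<pi>(1)] by simp
qed

text \<open>Schur: the squared moduli of the entries of a unitary matrix are doubly stochastic.\<close>
lemma diagonal_le_spectral: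
  assumes A: "A \<in> hermitian_mats n" and U: "unitary_mat n U"
  shows "F (\<lambda>i. Re ((mat_adjoint U * A * U) $$ (i, i))) \<le> spectral A"
proof -
  obtain V l where V: "unitary_mat n V" and AV: "A = V * real_diag_mat n l * mat_adjoint V"
    using hermitian_diagonalization[OF A] by blast
  \<comment> \<open>\<open>W\<close> is the change of basis between the columns of \<open>U\<close>
    and an eigenbasis of \<open>A\<close>; its squared moduli are the doubly stochastic
    weights.\<close>
  define W where "W = mat_adjoint U * V"
  have W: "unitary_mat n W"
    unfolding W_def by (intro unitary_mat_mult unitary_mat_adjoint U V)
  have conj: "mat_adjoint U * A * U = W * real_diag_mat n l * mat_adjoint W"
    using unitary_conj_mult[OF unitary_mat_adjoint[OF U] V, of "real_diag_mat n l"]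
    by (simp add: AV W_def)
  have "F (\<lambda>i. Re ((mat_adjoint U * A * U) $$ (i, i))) = F (\<lambda>i. \<Sum>j<n. (cmod (W $$ (i, j)))\<^sup>2 * l j)"
    unfolding conj
    by (intro cong) (simp add: diag_conjugated_real_diag[OF unitary_mat_carrier[OF W]] del: of_real_sum)
  also have "\<dots> \<le> F l"
    using unitary_mat_row_sum[OF W] unitary_mat_col_sum[OF W] by (intro doubly_stochastic) auto
  also have "\<dots> = spectral A" unfolding AV by (rule spectral_diag[OF V, symmetric])
  finally show ?thesis .
qed

lemma spectral_triangle:
  assumes A: "A \<in> hermitian_mats n" and B: "B \<in> hermitian_mats n"
  shows "spectral (A + B) \<le> spectral A + spectral B"
proof -
  note c = hermitian_mats_carrier[OF A] hermitian_mats_carrier[OF B]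
  obtain U l where U: "unitary_mat n U" and AB: "A + B = U * real_diag_mat n l * mat_adjoint U"
    using hermitian_diagonalization[OF hermitian_mats_add[OF A B]] by blast
  note Uc = unitary_mat_carrier[OF U]
  let ?diag = "\<lambda>A i. Re ((mat_adjoint U * A * U) $$ (i, i))"
  have "l i = ?diag A i + ?diag B i" if i: "i < n" for i
  proof -
    have "mat_adjoint U * (A + B) * U = 1\<^sub>m n * real_diag_mat n l * mat_adjoint (1\<^sub>m n)"
      using unitary_conj_mult[OF unitary_mat_adjoint[OF U] U, of "real_diag_mat n l"]
      by (simp add: AB unitary_mat_left[OF U])
    also have "\<dots> = real_diag_mat n l" by (simp add: right_mult_one_mat[of _ n n])
    finally have "real_diag_mat n l = mat_adjoint U * (A + B) * U" ..
    also have "mat_adjoint U * (A + B) = mat_adjoint U * A + mat_adjoint U * B"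
      using c Uc by (intro mult_add_distrib_mat) auto
    also have "\<dots> * U = mat_adjoint U * A * U + mat_adjoint U * B * U"
      using c Uc by (intro add_mult_distrib_mat[of _ n n]) auto
    finally have "real_diag_mat n l $$ (i, i)
        = (mat_adjoint U * A * U) $$ (i, i) + (mat_adjoint U * B * U) $$ (i, i)"
      using c Uc i by simp
    then have "complex_of_real (l i)
        = (mat_adjoint U * A * U) $$ (i, i) + (mat_adjoint U * B * U) $$ (i, i)"
      using i by (simp add: real_diag_mat_def)
    from arg_cong[OF this, of Re] show ?thesis by simp
  qed
  then have "F l = F (\<lambda>i. ?diag A i + ?diag B i)" by (intro cong) auto
  also have "\<dots> \<le> F (?diag A) + F (?diag B)" by (rule triangle)
  also have "\<dots> \<le> spectral A + spectral B"
    by (intro add_mono diagonal_le_spectral A B U)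
  finally show ?thesis unfolding AB spectral_diag[OF U] .
qed

text \<open>A negative factor reverses the sorted list of eigenvalues; scaling a diagonalization
  instead avoids the order altogether.\<close>

lemma spectral_smult:
  assumes A: "A \<in> hermitian_mats n"
  shows "spectral (complex_of_real c \<cdot>\<^sub>m A) = \<bar>c\<bar> * spectral A"
proof -
  obtain U l where U: "unitary_mat n U" and AU: "A = U * real_diag_mat n l * mat_adjoint U"
    using hermitian_diagonalization[OF A] by blast
  note Uc = unitary_mat_carrier[OF U]
  have "real_diag_mat n (\<lambda>i. c * l i) = complex_of_real c \<cdot>\<^sub>m real_diag_mat n l"
    by (intro eq_matI) (auto simp: real_diag_mat_def)
  then have "U * real_diag_mat n (\<lambda>i. c * l i) * mat_adjoint U = complex_of_real c \<cdot>\<^sub>m A"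
    using Uc by (simp add: AU mult_smult_distrib[of _ n n _ n] mult_smult_assoc_mat[of _ n n _ n])
  then have "spectral (complex_of_real c \<cdot>\<^sub>m A) = F (\<lambda>i. c * l i)"
    using spectral_diag[OF U, of "\<lambda>i. c * l i"] by simp
  then show ?thesis by (simp add: scale AU spectral_diag[OF U])
qed

lemma spectral_eq_0_imp:
  assumes definite: "\<And>l i. F l = 0 \<Longrightarrow> i < n \<Longrightarrow> l i = 0"
    and A: "A \<in> hermitian_mats n" and zero: "spectral A = 0"
  shows "A = 0\<^sub>m n n"
proof -
  obtain U l where U: "unitary_mat n U" and AU: "A = U * real_diag_mat n l * mat_adjoint U"
    using hermitian_diagonalization[OF A] by blast
  note Uc = unitary_mat_carrier[OF U]
  have "F l = 0" using zero by (simp add: AU spectral_diag[OF U])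
  then have "real_diag_mat n l = 0\<^sub>m n n"
    using definite[of l] by (intro eq_matI) (auto simp: real_diag_mat_def)
  then show ?thesis using Uc by (simp add: AU left_mult_zero_mat[of _ n n] right_mult_zero_mat[of _ n n])
qed

end

section \<open>Minkowski's inequality and linear forms of iid vectors\<close>

text \<open>For positive arguments this is convexity of the power. When one argument is 0 it reduces
  to \<open>r powr d \<le> r\<close> on the unit interval.\<close>

lemma powr_convex_comb:
  fixes u v s d :: real
  assumes d: "1 \<le> d" and uv: "0 \<le> u" "0 \<le> v" and s: "0 \<le> s" "s \<le> 1"
  shows "((1 - s) * u + s * v) powr d \<le> (1 - s) * u powr d + s * v powr d"
proof -
  have le: "r powr d \<le> r" if "0 \<le> r" "r \<le> 1" for r :: real
    using powr_mono'[of 1 d r] that d by (cases "r = 0") auto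
  consider "u = 0" | "v = 0" | "0 < u" "0 < v" using uv by fastforce
  then show ?thesis
  proof cases
    case 1
    then show ?thesis using le[of s] s uv by (simp add: powr_mult mult_right_mono)
  next
    case 2
    then show ?thesis using le[of "1 - s"] s uv by (simp add: powr_mult mult_right_mono)
  next
    case 3
    then show ?thesis using convex_onD[OF powr_convex[OF d], of s u v] s by simp
  qed
qed

text \<open>The sum is twice a midpoint, so convexity bounds its power by a multiple of the two
  integrable powers; the doubling produces the factor \<open>2 powr d\<close>.\<close>

lemma integrable_abs_powr_add:
  fixes f g :: "'a \<Rightarrow> real"
  assumes d: "1 \<le> d"
    and [measurable]: "f \<in> borel_measurable M" "g \<in> borel_measurable M"
    and int: "integrable M (\<lambda>x. \<bar>f x\<bar> powr d)" "integrable M (\<lambda>x. \<bar>g x\<bar> powr d)"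
  shows "integrable M (\<lambda>x. \<bar>f x + g x\<bar> powr d)"
proof (rule Bochner_Integration.integrable_bound)
  show "integrable M (\<lambda>x. 2 powr d * (\<bar>f x\<bar> powr d + \<bar>g x\<bar> powr d))" using int by simp
  have "\<bar>f x + g x\<bar> powr d \<le> 2 powr d * (\<bar>f x\<bar> powr d + \<bar>g x\<bar> powr d)" for x
  proof -
    have "\<bar>f x + g x\<bar> powr d \<le> (2 * ((1 - 1/2) * \<bar>f x\<bar> + 1/2 * \<bar>g x\<bar>)) powr d"
      using d by (intro powr_mono2) auto
    also have "\<dots> = 2 powr d * ((1 - 1/2) * \<bar>f x\<bar> + 1/2 * \<bar>g x\<bar>) powr d"
      by (subst powr_mult) auto
    also have "\<dots> \<le> 2 powr d * ((1 - 1/2) * \<bar>f x\<bar> powr d + 1/2 * \<bar>g x\<bar> powr d)"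
      using d by (intro mult_left_mono powr_convex_comb) auto
    also have "\<dots> \<le> 2 powr d * (\<bar>f x\<bar> powr d + \<bar>g x\<bar> powr d)"
      by (intro mult_left_mono add_mono mult_left_le_one_le) auto
    finally show ?thesis .
  qed
  then show "AE x in M. norm (\<bar>f x + g x\<bar> powr d)
      \<le> norm (2 powr d * (\<bar>f x\<bar> powr d + \<bar>g x\<bar> powr d))"
    by simp
qed measurable

text \<open>If \<open>a\<close> and \<open>b\<close> bound the two norms, then
  \<open>\<bar>f x\<bar> + \<bar>g x\<bar>\<close> is \<open>a + b\<close> times a convex
  combination of \<open>\<bar>f x\<bar> / a\<close> and \<open>\<bar>g x\<bar> / b\<close>.
  Convexity of the power, integrated, bounds the integral by \<open>(a + b) powr d\<close>.\<close>

lemma Minkowski_inequality: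
  fixes f g :: "'a \<Rightarrow> real"
  assumes d: "1 \<le> d"
    and [measurable]: "f \<in> borel_measurable M" "g \<in> borel_measurable M"
    and int: "integrable M (\<lambda>x. \<bar>f x\<bar> powr d)" "integrable M (\<lambda>x. \<bar>g x\<bar> powr d)"
  shows "(LINT x|M. \<bar>f x + g x\<bar> powr d) powr (1 / d)
    \<le> (LINT x|M. \<bar>f x\<bar> powr d) powr (1 / d) + (LINT x|M. \<bar>g x\<bar> powr d) powr (1 / d)"
    (is "?L \<le> ?A + ?B")
proof (rule field_le_epsilon)
  fix e :: real assume e: "0 < e"
  \<comment> \<open>The slack keeps \<open>a\<close> and \<open>b\<close> positive even when a norm
    is 0, so that both divisions make sense.\<close>
  define a b where "a = ?A + e / 2" and "b = ?B + e / 2"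
  have ab: "0 < a" "0 < b" "?A \<le> a" "?B \<le> b"
    using e by (auto simp: a_def b_def add_nonneg_pos)
  have bound: "(LINT x|M. \<bar>h x\<bar> powr d) \<le> c powr d"
    if "(LINT x|M. \<bar>h x\<bar> powr d) powr (1 / d) \<le> c" for h :: "'a \<Rightarrow> real" and c
  proof -
    have "(LINT x|M. \<bar>h x\<bar> powr d) = ((LINT x|M. \<bar>h x\<bar> powr d) powr (1 / d)) powr d"
      using d by (simp add: powr_powr integral_nonneg_AE)
    also have "\<dots> \<le> c powr d" using that d by (intro powr_mono2) auto
    finally show ?thesis .
  qed
  define s where "s = b / (a + b)"
  have s: "0 \<le> s" "s \<le> 1" "1 - s = a / (a + b)" using ab by (auto simp: s_def field_simps)
  have pointwise: "\<bar>f x + g x\<bar> powr d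
      \<le> (a + b) powr d * ((1 - s) / a powr d * \<bar>f x\<bar> powr d + s / b powr d * \<bar>g x\<bar> powr d)" for x
  proof -
    have "\<bar>f x + g x\<bar> \<le> \<bar>f x\<bar> + \<bar>g x\<bar>" by simp
    also have "\<dots> = (a + b) * ((1 - s) * (\<bar>f x\<bar> / a) + s * (\<bar>g x\<bar> / b))"
    proof -
      have "a \<noteq> 0" "b \<noteq> 0" "a + b \<noteq> 0" using ab by auto
      then show ?thesis unfolding s(3) unfolding s_def by (simp add: distrib_left)
    qed
    finally have "\<bar>f x + g x\<bar> powr d
        \<le> ((a + b) * ((1 - s) * (\<bar>f x\<bar> / a) + s * (\<bar>g x\<bar> / b))) powr d"
      using d by (intro powr_mono2) auto
    also have "\<dots> = (a + b) powr d * ((1 - s) * (\<bar>f x\<bar> / a) + s * (\<bar>g x\<bar> / b)) powr d"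
      using ab s by (subst powr_mult) auto
    also have "\<dots> \<le> (a + b) powr d * ((1 - s) * (\<bar>f x\<bar> / a) powr d + s * (\<bar>g x\<bar> / b) powr d)"
      using d ab s by (intro mult_left_mono powr_convex_comb) auto
    finally show ?thesis using ab by (simp add: powr_divide)
  qed
  have "(LINT x|M. \<bar>f x + g x\<bar> powr d) \<le> (LINT x|M. (a + b) powr d *
      ((1 - s) / a powr d * \<bar>f x\<bar> powr d + s / b powr d * \<bar>g x\<bar> powr d))"
    using int pointwise by (intro integral_mono integrable_abs_powr_add d) auto
  also have "\<dots> = (a + b) powr d * ((1 - s) / a powr d * (LINT x|M. \<bar>f x\<bar> powr d)
      + s / b powr d * (LINT x|M. \<bar>g x\<bar> powr d))"
    using int by simp
  also have "\<dots> \<le> (a + b) powr d * ((1 - s) / a powr d * a powr d + s / b powr d * b powr d)"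
    using s bound[of f a] bound[of g b] ab by (intro mult_left_mono add_mono) auto
  also have "\<dots> = (a + b) powr d" using ab by simp
  finally have "?L \<le> ((a + b) powr d) powr (1 / d)"
    using d by (intro powr_mono2) (auto simp: integral_nonneg_AE)
  also have "\<dots> = ?A + ?B + e" using d ab by (simp add: powr_powr a_def b_def)
  finally show "?L \<le> ?A + ?B + e" .
qed

text \<open>
  Composing with \<open>arctan\<close> makes second moments available; independence then forces the
  variance to vanish.
\<close>
lemma (in prob_space) indep_opposite_imp_constant:
  fixes Y Z :: "'a \<Rightarrow> real"
  assumes indep: "indep_var borel Y borel Z" and zero: "AE \<omega> in M. Y \<omega> + Z \<omega> = 0"
  shows "\<exists>c. AE \<omega> in M. Y \<omega> = c"
proof -
  have [measurable]: "Y \<in> borel_measurable M" "Z \<in> borel_measurable M"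
    using indep_var_rv1[OF indep] indep_var_rv2[OF indep] by auto
  define f g where "f = (\<lambda>\<omega>. arctan (Y \<omega>))" and "g = (\<lambda>\<omega>. arctan (Z \<omega>))"
  have [measurable]: "f \<in> borel_measurable M" "g \<in> borel_measurable M"
    by (simp_all add: f_def g_def)
  \<comment> \<open>The true bound is pi / 2, which is below 2 since pi is below 4.\<close>
  have bound: "\<bar>arctan t\<bar> \<le> 2" for t :: real
    using arctan_bounded[of t] pi_less_4 by linarith
  have int_f: "integrable M f" by (rule integrable_const_bound[of _ 2]) (simp_all add: f_def bound)
  have int_g: "integrable M g" by (rule integrable_const_bound[of _ 2]) (simp_all add: g_def bound)
  have indep_fg: "indep_var borel f borel g"
    using indep_var_compose[OF indep, of arctan borel arctan borel]
    by (simp add: f_def g_def comp_def)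
  \<comment> \<open>As \<open>arctan\<close> is odd, the relation between \<open>Y\<close> and
    \<open>Z\<close> survives the composition.\<close>
  have opp: "AE \<omega> in M. g \<omega> = - f \<omega>"
    using zero
  proof eventually_elim
    case (elim \<omega>)
    then have "Z \<omega> = - Y \<omega>" by simp
    then show ?case by (simp add: f_def g_def arctan_minus)
  qed
  define m where "m = expectation f"
  have "expectation g = - m"
    using opp by (subst integral_cong_AE[of g M "\<lambda>\<omega>. - f \<omega>"]) (auto simp: m_def)
  moreover have "expectation (\<lambda>\<omega>. f \<omega> * g \<omega>) = - expectation (\<lambda>\<omega>. (f \<omega>)\<^sup>2)"
  proof -
    have "AE \<omega> in M. f \<omega> * g \<omega> = - (f \<omega>)\<^sup>2"
      using opp by eventually_elim (simp add: power2_eq_square)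
    then have "expectation (\<lambda>\<omega>. f \<omega> * g \<omega>) = expectation (\<lambda>\<omega>. - (f \<omega>)\<^sup>2)"
      by (intro integral_cong_AE) auto
    then show ?thesis by simp
  qed
  \<comment> \<open>By independence the expectation of \<open>f \<omega> * g \<omega>\<close> is
    \<open>m * (- m)\<close>. The second moment is then the square of the mean, so the variance is
    0.\<close>
  ultimately have square: "expectation (\<lambda>\<omega>. (f \<omega>)\<^sup>2) = m\<^sup>2"
    using indep_var_lebesgue_integral[OF indep_fg int_f int_g]
    by (simp add: m_def power2_eq_square)
  have "\<bar>(f \<omega>)\<^sup>2\<bar> \<le> 4" for \<omega>
    using power_mono[OF bound, of "Y \<omega>" 2] by (simp add: f_def)
  then have int_f2: "integrable M (\<lambda>\<omega>. (f \<omega>)\<^sup>2)"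
    by (intro integrable_const_bound[of _ 4]) auto
  have expand: "(f \<omega> - m)\<^sup>2 = (f \<omega>)\<^sup>2 - 2 * m * f \<omega> + m\<^sup>2" for \<omega>
    by (simp add: power2_eq_square algebra_simps)
  have "expectation (\<lambda>\<omega>. (f \<omega> - m)\<^sup>2) = 0"
    unfolding expand using int_f int_f2 square
    by (simp add: m_def[symmetric] prob_space power2_eq_square)
  moreover have "integrable M (\<lambda>\<omega>. (f \<omega> - m)\<^sup>2)" unfolding expand using int_f int_f2 by simp
  ultimately have "AE \<omega> in M. (f \<omega> - m)\<^sup>2 = 0"
    by (subst (asm) integral_nonneg_eq_0_iff_AE) auto
  then have "AE \<omega> in M. Y \<omega> = tan m"
  proof eventually_elim
    case (elim \<omega>)
    then have "arctan (Y \<omega>) = m" by (simp add: f_def)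
    then show ?case using tan_arctan[of "Y \<omega>"] by simp
  qed
  then show ?thesis ..
qed

section \<open>Linear forms of iid random vectors\<close>

locale iid_vector = prob_space M
  for M :: "'a measure" +
  fixes X :: "nat \<Rightarrow> 'a \<Rightarrow> real" and d :: real and n :: nat
  assumes d_ge_1: "1 \<le> d" and n_pos: "0 < n"
    and measurable_X: "i < n \<Longrightarrow> X i \<in> borel_measurable M"
    and integrable_X: "i < n \<Longrightarrow> integrable M (\<lambda>\<omega>. \<bar>X i \<omega>\<bar> powr d)"
    and nondegenerate: "i < n \<Longrightarrow> \<not> (\<exists>c. AE \<omega> in M. X i \<omega> = c)"
    and indep: "indep_vars (\<lambda>_. borel) X {..<n}"
    and identical: "i < n \<Longrightarrow> j < n \<Longrightarrow> distr M borel (X i) = distr M borel (X j)"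
begin

definition inner_norm :: "(nat \<Rightarrow> real) \<Rightarrow> real" where
  "inner_norm l =
    ((LINT \<omega>|M. \<bar>\<Sum>i<n. X i \<omega> * l i\<bar> powr d) / Gamma (d + 1)) powr (1 / d)"

lemma Gamma_pos: "0 < Gamma (d + 1)"
  using d_ge_1 by (intro Gamma_real_pos) auto

lemma measurable_inner [measurable]: "(\<lambda>\<omega>. \<Sum>i<n. X i \<omega> * l i) \<in> borel_measurable M"
  using measurable_X by (intro borel_measurable_sum) auto

lemma integrable_inner: "integrable M (\<lambda>\<omega>. \<bar>\<Sum>i<n. X i \<omega> * l i\<bar> powr d)"
proof -
  have "integrable M (\<lambda>\<omega>. \<bar>\<Sum>i<m. X i \<omega> * l i\<bar> powr d)" if "m \<le> n" for m
    using that
  proof (induction m)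
    case (Suc m)
    then have [measurable]: "X i \<in> borel_measurable M" if "i \<le> m" for i
      using measurable_X that by simp
    have "integrable M (\<lambda>\<omega>. \<bar>(\<Sum>i<m. X i \<omega> * l i) + X m \<omega> * l m\<bar> powr d)"
    proof (intro integrable_abs_powr_add d_ge_1)
      show "integrable M (\<lambda>\<omega>. \<bar>X m \<omega> * l m\<bar> powr d)"
        using integrable_X[of m] Suc.prems by (simp add: abs_mult powr_mult)
    qed (use Suc in auto)
    then show ?case by simp
  qed simp
  then show ?thesis by simp
qed

lemma inner_norm_eq:
  "inner_norm l = (LINT \<omega>|M. \<bar>\<Sum>i<n. X i \<omega> * l i\<bar> powr d) powr (1 / d)
     / Gamma (d + 1) powr (1 / d)"
  unfolding inner_norm_def by (rule powr_divide)

text \<open>The joint law of \<open>X\<close> is a product \<open>P\<close> of equal factors and so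
  is invariant under reindexing. Permuting the coefficients by \<open>\<pi>\<close> amounts to
  permuting the coordinates of \<open>X\<close> by the inverse of \<open>\<pi>\<close>.\<close>

lemma inner_norm_permute:
  assumes \<pi>: "\<pi> permutes {..<n}"
  shows "inner_norm (l \<circ> \<pi>) = inner_norm l"
proof -
  define \<sigma> where "\<sigma> = inv_into UNIV \<pi>"
  have \<sigma>: "\<sigma> permutes {..<n}" unfolding \<sigma>_def by (rule permutes_inv[OF \<pi>])
  define D where "D = distr M borel (X 0)"
  define P where "P = (\<Pi>\<^sub>M i\<in>{..<n}. D)"
  have D: "prob_space D" unfolding D_def using measurable_X[OF n_pos] by (rule prob_space_distr)
  have sets_P: "sets P = sets (\<Pi>\<^sub>M i\<in>{..<n}. borel :: real measure)"
    unfolding P_def D_def by (intro sets_PiM_cong) auto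
  have X_meas: "(\<lambda>\<omega>. \<lambda>i\<in>{..<n}. X i \<omega>) \<in> measurable M (\<Pi>\<^sub>M i\<in>{..<n}. borel)"
    using measurable_X by (intro measurable_restrict) auto
  have joint: "distr M (\<Pi>\<^sub>M i\<in>{..<n}. borel) (\<lambda>\<omega>. \<lambda>i\<in>{..<n}. X i \<omega>) = P"
  proof -
    have "distr M (\<Pi>\<^sub>M i\<in>{..<n}. borel) (\<lambda>\<omega>. \<lambda>i\<in>{..<n}. X i \<omega>)
        = (\<Pi>\<^sub>M i\<in>{..<n}. distr M borel (X i))"
      using indep measurable_X n_pos
      by (subst indep_vars_iff_distr_eq_PiM'[symmetric]) auto
    also have "\<dots> = P"
      unfolding P_def D_def by (intro PiM_cong refl identical n_pos) simp
    finally show ?thesis .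
  qed
  have "inj_on \<sigma> {..<n}" "\<sigma> \<in> {..<n} \<rightarrow> {..<n}"
    using permutes_inj_on[OF \<sigma>] permutes_in_image[OF \<sigma>] by auto
  then have reindex: "distr P P (\<lambda>x. \<lambda>i\<in>{..<n}. x (\<sigma> i)) = P"
    using distr_PiM_reindex[of "{..<n}" "\<lambda>_. D" \<sigma> "{..<n}"] D by (simp add: P_def)
  have inner_P: "(\<lambda>x. \<bar>\<Sum>i<n. x i * k i\<bar> powr d) \<in> borel_measurable P" for k :: "nat \<Rightarrow> real"
  proof -
    have "(\<lambda>x. x i) \<in> borel_measurable P" if "i < n" for i
      using measurable_component_singleton[of i "{..<n}" "\<lambda>_. borel :: real measure"] that
      by (simp add: measurable_cong_sets[OF sets_P])
    then have [measurable]: "(\<lambda>x. \<Sum>i<n. x i * k i) \<in> borel_measurable P"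
      by (intro borel_measurable_sum borel_measurable_times) auto
    show ?thesis by measurable
  qed
  have expect: "(LINT \<omega>|M. \<bar>\<Sum>i<n. X i \<omega> * k i\<bar> powr d) = (LINT x|P. \<bar>\<Sum>i<n. x i * k i\<bar> powr d)"
    for k :: "nat \<Rightarrow> real"
  proof -
    have "(LINT x|distr M (\<Pi>\<^sub>M i\<in>{..<n}. borel) (\<lambda>\<omega>. \<lambda>i\<in>{..<n}. X i \<omega>). \<bar>\<Sum>i<n. x i * k i\<bar> powr d)
        = (LINT \<omega>|M. \<bar>\<Sum>i<n. (\<lambda>i\<in>{..<n}. X i \<omega>) i * k i\<bar> powr d)"
      by (rule integral_distr[OF X_meas]) (use inner_P in \<open>simp add: measurable_cong_sets[OF sets_P]\<close>)
    then show ?thesis unfolding joint by simp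
  qed
  have \<sigma>_meas: "(\<lambda>x. \<lambda>i\<in>{..<n}. x (\<sigma> i)) \<in> measurable P P"
    unfolding P_def using permutes_in_image[OF \<sigma>]
    by (intro measurable_restrict measurable_component_singleton) auto
  have sum_eq: "(\<Sum>i<n. x (\<sigma> i) * l i) = (\<Sum>i<n. x i * (l \<circ> \<pi>) i)" for x :: "nat \<Rightarrow> real"
    using sum.permute[OF \<pi>, of "\<lambda>i. x (\<sigma> i) * l i"] permutes_inverses[OF \<pi>]
    by (simp add: \<sigma>_def comp_def)
  have "(LINT x|P. \<bar>\<Sum>i<n. x i * l i\<bar> powr d)
      = (LINT x|distr P P (\<lambda>x. \<lambda>i\<in>{..<n}. x (\<sigma> i)). \<bar>\<Sum>i<n. x i * l i\<bar> powr d)"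
    by (simp only: reindex)
  also have "\<dots> = (LINT x|P. \<bar>\<Sum>i<n. x (\<sigma> i) * l i\<bar> powr d)"
    by (subst integral_distr[OF \<sigma>_meas inner_P]) simp
  also have "\<dots> = (LINT x|P. \<bar>\<Sum>i<n. x i * (l \<circ> \<pi>) i\<bar> powr d)"
    by (simp only: sum_eq)
  finally show ?thesis unfolding inner_norm_def expect by simp
qed

sublocale symmetric_seminorm n inner_norm
proof
  fix x y :: "nat \<Rightarrow> real"
  assume "\<And>i. i < n \<Longrightarrow> x i = y i"
  then show "inner_norm x = inner_norm y" by (simp add: inner_norm_def)
next
  fix \<pi> and x :: "nat \<Rightarrow> real" assume "\<pi> permutes {..<n}"
  then show "inner_norm (x \<circ> \<pi>) = inner_norm x" by (rule inner_norm_permute)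
next
  fix x y :: "nat \<Rightarrow> real"
  have "(LINT \<omega>|M. \<bar>(\<Sum>i<n. X i \<omega> * x i) + (\<Sum>i<n. X i \<omega> * y i)\<bar> powr d) powr (1 / d)
      \<le> (LINT \<omega>|M. \<bar>\<Sum>i<n. X i \<omega> * x i\<bar> powr d) powr (1 / d)
        + (LINT \<omega>|M. \<bar>\<Sum>i<n. X i \<omega> * y i\<bar> powr d) powr (1 / d)"
    by (intro Minkowski_inequality d_ge_1 measurable_inner integrable_inner)
  then show "inner_norm (\<lambda>i. x i + y i) \<le> inner_norm x + inner_norm y"
    unfolding inner_norm_eq add_divide_distrib[symmetric]
    by (intro divide_right_mono) (simp_all add: ring_distribs sum.distrib)
next
  fix c :: real and x :: "nat \<Rightarrow> real"
  have "\<bar>\<Sum>i<n. X i \<omega> * (c * x i)\<bar> powr d = \<bar>c\<bar> powr d * \<bar>\<Sum>i<n. X i \<omega> * x i\<bar> powr d" for \<omega>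
  proof -
    have "(\<Sum>i<n. X i \<omega> * (c * x i)) = c * (\<Sum>i<n. X i \<omega> * x i)"
      by (simp add: sum_distrib_left mult_ac)
    then show ?thesis by (simp add: abs_mult powr_mult)
  qed
  then have "(LINT \<omega>|M. \<bar>\<Sum>i<n. X i \<omega> * (c * x i)\<bar> powr d)
      = \<bar>c\<bar> powr d * (LINT \<omega>|M. \<bar>\<Sum>i<n. X i \<omega> * x i\<bar> powr d)"
    by simp
  then show "inner_norm (\<lambda>i. c * x i) = \<bar>c\<bar> * inner_norm x"
    using d_ge_1 by (simp add: inner_norm_eq powr_mult powr_powr integral_nonneg_AE)
qed

text \<open>If \<open>l k\<close> were nonzero, \<open>X k \<omega> * l k\<close> would almost
  surely be the negative of the sum of the other terms, which is independent of it. Then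
  \<open>X k\<close> would be almost surely constant.\<close>

lemma inner_norm_eq_0_imp:
  assumes "inner_norm l = 0" "k < n"
  shows "l k = 0"
proof (rule ccontr)
  assume lk: "l k \<noteq> 0"
  have "(LINT \<omega>|M. \<bar>\<Sum>i<n. X i \<omega> * l i\<bar> powr d) = 0"
    using assms(1) Gamma_pos by (simp add: inner_norm_def)
  then have "AE \<omega> in M. \<bar>\<Sum>i<n. X i \<omega> * l i\<bar> powr d = 0"
    by (subst (asm) integral_nonneg_eq_0_iff_AE) (auto intro: integrable_inner)
  then have zero: "AE \<omega> in M. X k \<omega> * l k + (\<Sum>i\<in>{..<n} - {k}. X i \<omega> * l i) = 0"
    using assms(2) by (simp add: sum.remove[of "{..<n}" k])
  have "insert k ({..<n} - {k}) = {..<n}" using assms(2) by auto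
  moreover have "indep_vars (\<lambda>_. borel) (\<lambda>i \<omega>. X i \<omega> * l i) {..<n}"
    by (rule indep_vars_compose2[OF indep]) simp
  ultimately have "indep_var borel (\<lambda>\<omega>. X k \<omega> * l k) borel (\<lambda>\<omega>. \<Sum>i\<in>{..<n} - {k}. X i \<omega> * l i)"
    by (intro indep_vars_sum) auto
  from indep_opposite_imp_constant[OF this zero]
  obtain c where "AE \<omega> in M. X k \<omega> * l k = c" by blast
  then have "AE \<omega> in M. X k \<omega> = c / l k" by eventually_elim (use lk in \<open>simp add: field_simps\<close>)
  then show False using nondegenerate[OF assms(2)] by blast
qed

end

section \<open>The integral of a power of the cosine\<close>

text \<open>The part of the shifted interval that sticks out beyond \<open>p\<close> is moved back
  by one period.\<close>

lemma integral_periodic_shift: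
  fixes f :: "real \<Rightarrow> real"
  assumes cont: "continuous_on UNIV f" and period: "\<And>x. f (x + p) = f x"
    and c: "0 \<le> c" "c \<le> p"
  shows "integral {0..p} (\<lambda>x. f (x + c)) = integral {0..p} f"
proof -
  have int: "f integrable_on {a..b}" for a b
    by (intro integrable_continuous_real continuous_on_subset[OF cont]) auto
  have "integral {0..p} (\<lambda>x. f (x + c)) = integral {c..p + c} f"
    using integral_shift[of 0 c p f] continuous_on_subset[OF cont] by (simp add: comp_def)
  also have "\<dots> = integral {c..p} f + integral {p..p + c} f"
    using c int by (intro Henstock_Kurzweil_Integration.integral_combine[symmetric]) auto
  also have "integral {p..p + c} f = integral {0..c} f"
    using integral_shift[of 0 p c f] continuous_on_subset[OF cont] period
    by (simp add: comp_def add.commute)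
  also have "integral {c..p} f + integral {0..c} f = integral {0..p} f"
    using c int Henstock_Kurzweil_Integration.integral_combine[of 0 c p f] by simp
  finally show ?thesis .
qed

lemma continuous_on_abs_powr [continuous_intros]:
  fixes f :: "'a::topological_space \<Rightarrow> real"
  assumes "continuous_on S f" "0 < d"
  shows "continuous_on S (\<lambda>x. \<bar>f x\<bar> powr d)"
  using assms by (intro continuous_on_powr' continuous_intros) auto

text \<open>The substitution of the square of \<open>sin x\<close> for the variable in the Beta
  integral.\<close>

lemma integral_sin_powr:
  fixes d :: real
  assumes d: "1 \<le> d"
  shows "integral {0..pi / 2} (\<lambda>x. \<bar>sin x\<bar> powr d) = Beta ((d + 1) / 2) (1 / 2) / 2"
proof -
  define f :: "real \<Rightarrow> real"
    where "f = (\<lambda>t. t powr ((d + 1) / 2 - 1) * (1 - t) powr (1 / 2 - 1))"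
  define g' :: "real \<Rightarrow> real" where "g' = (\<lambda>x. 2 * sin x * cos x)"
  have f: "set_integrable lborel {0..1} f"
    unfolding f_def using d by (intro integrable_Beta) auto
  have deriv: "((\<lambda>x. (sin x)\<^sup>2) has_real_derivative g' x) (at x)" for x
    by (auto intro!: derivative_eq_intros simp: g'_def)
  have g'_nonneg: "0 \<le> g' x" if "x \<in> {0..pi / 2}" for x
    using that by (auto simp: g'_def intro!: mult_nonneg_nonneg sin_ge_zero cos_ge_zero)
  have cont: "continuous_on {0..pi / 2} g'" unfolding g'_def by (intro continuous_intros)
  have "Beta ((d + 1) / 2) (1 / 2) = integral {0..1} f"
    unfolding f_def using d by (intro has_integral_Beta_real[THEN integral_unique, symmetric]) auto
  also have "\<dots> = (LBINT t. f t * indicator {0..1} t)"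
    using set_borel_integral_eq_integral(2)[OF f]
    by (simp add: set_lebesgue_integral_def mult.commute)
  also have "\<dots> = (LBINT x. f ((sin x)\<^sup>2) * g' x * indicator {0..pi / 2} x)"
    using integral_substitution(2)[of "\<lambda>x. (sin x)\<^sup>2" 0 "pi / 2" f g'] f deriv cont g'_nonneg
    by simp
  also have "\<dots> = (LBINT x. 2 * \<bar>sin x\<bar> powr d * indicator {0..pi / 2} x)"
  proof (rule integral_cong_AE)
    \<comment> \<open>At pi / 2 the convention \<open>0 powr a = 0\<close> makes the left side 0
      while the right side is 2, and at 0 the computation would divide by \<open>sin x\<close>. Both
      points are null sets.\<close>
    have "AE x in lborel. x \<noteq> 0" "AE x in lborel. x \<noteq> pi / 2"
      by (rule AE_lborel_singleton)+
    then show "AE x in lborel. f ((sin x)\<^sup>2) * g' x * indicator {0..pi / 2} x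
        = 2 * \<bar>sin x\<bar> powr d * indicator {0..pi / 2} x"
    proof eventually_elim
      case (elim x)
      show ?case
      proof (cases "x \<in> {0..pi / 2}")
        case True
        then have sc: "0 < sin x" "0 < cos x"
          using elim by (auto intro!: sin_gt_zero cos_gt_zero)
        have square: "(u\<^sup>2) powr a = u powr (2 * a)" if "0 < u" for u a :: real
          using that by (simp add: powr_powr flip: powr_numeral)
        have "1 - (sin x)\<^sup>2 = (cos x)\<^sup>2" by (simp add: cos_squared_eq)
        then have "f ((sin x)\<^sup>2) = sin x powr (2 * ((d + 1) / 2 - 1)) * cos x powr (2 * (1 / 2 - 1))"
          by (simp only: f_def square[OF sc(1)] square[OF sc(2)])
        also have "2 * ((d + 1) / 2 - 1) = d - 1" by (simp add: field_simps)
        also have "cos x powr (2 * (1 / 2 - 1)) = 1 / cos x"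
          using sc by (simp add: powr_minus_divide)
        finally show ?thesis
          using sc by (simp add: g'_def powr_diff)
      qed simp
    qed
  qed (simp_all add: f_def g'_def)
  also have "\<dots> = 2 * integral {0..pi / 2} (\<lambda>x. \<bar>sin x\<bar> powr d)"
  proof -
    have "set_integrable lborel {0..pi / 2} (\<lambda>x. \<bar>sin x\<bar> powr d)"
      using d by (intro borel_integrable_atLeastAtMost' continuous_intros) auto
    from set_borel_integral_eq_integral(2)[OF this] show ?thesis
      by (simp add: set_lebesgue_integral_def mult_ac)
  qed
  finally show ?thesis by simp
qed

lemma central_binomial_pos:
  assumes "1 \<le> d"
  shows "0 < central_binomial d"
  unfolding central_binomial_def using assms
  by (intro divide_pos_pos zero_less_power Gamma_real_pos) auto

text \<open>Legendre's formula over the complex numbers, restricted to positive reals, where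
  \<open>Gamma\<close> has no poles.\<close>

lemma Gamma_duplication_real:
  fixes x :: real
  assumes "0 < x"
  shows "Gamma x * Gamma (x + 1 / 2) = 2 powr (1 - 2 * x) * sqrt pi * Gamma (2 * x)"
proof -
  have not: "complex_of_real y \<notin> \<int>\<^sub>\<le>\<^sub>0" if "0 < y" for y
    using that nonpos_Ints_nonpos[of y] by (auto simp: of_real_in_nonpos_Ints_iff)
  have half: "complex_of_real x + 1 / 2 = complex_of_real (x + 1 / 2)"
    and two: "2 * complex_of_real x = complex_of_real (2 * x)" by simp_all
  have expo: "(1 - 2 * complex_of_real x) * of_real (ln 2) = complex_of_real ((1 - 2 * x) * ln 2)"
    by simp
  have "Gamma (complex_of_real x) * Gamma (complex_of_real x + 1 / 2)
      = exp ((1 - 2 * complex_of_real x) * of_real (ln 2)) * of_real (sqrt pi)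
        * Gamma (2 * complex_of_real x)"
    unfolding half using assms by (intro Gamma_legendre_duplication[of "complex_of_real x",
        unfolded half] not) auto
  then have "complex_of_real (Gamma x * Gamma (x + 1 / 2))
      = complex_of_real (exp ((1 - 2 * x) * ln 2) * sqrt pi * Gamma (2 * x))"
    unfolding expo unfolding half two exp_of_real Gamma_complex_of_real
    by (simp only: of_real_mult)
  then have "Gamma x * Gamma (x + 1 / 2) = exp ((1 - 2 * x) * ln 2) * sqrt pi * Gamma (2 * x)"
    by (simp only: of_real_eq_iff)
  then show ?thesis by (simp add: powr_def)
qed

text \<open>A shift turns the cosine into the sine, whose absolute value has equal integrals over
  the four quarters of the period. Each quarter is half a Beta value, and the duplication formula at
  \<open>(d + 1) / 2\<close> evaluates the result.\<close>

lemma integral_abs_cos_powr: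
  fixes d :: real
  assumes d: "1 \<le> d"
  shows "integral {0..2 * pi} (\<lambda>x. \<bar>2 * cos x\<bar> powr d) = 2 * pi * central_binomial d"
proof -
  let ?f = "\<lambda>x::real. \<bar>sin x\<bar> powr d"
  have cont: "continuous_on S ?f" for S using d by (intro continuous_intros) auto
  then have int: "?f integrable_on {a..b}" for a b by (intro integrable_continuous_real) auto
  have "integral {0..2 * pi} (\<lambda>x. \<bar>cos x\<bar> powr d) = integral {0..2 * pi} (\<lambda>x. ?f (x + pi / 2))"
    by (simp add: sin_add)
  also have "\<dots> = integral {0..2 * pi} ?f"
    using cont by (intro integral_periodic_shift) auto
  also have "\<dots> = integral {0..pi} ?f + integral {pi..2 * pi} ?f"
    using int by (intro Henstock_Kurzweil_Integration.integral_combine[symmetric]) auto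
  also have "integral {pi..2 * pi} ?f = integral {0..pi} ?f"
    using integral_shift[of 0 pi pi ?f] cont by (simp add: comp_def)
  also have "integral {0..pi} ?f = integral {0..pi / 2} ?f + integral {pi / 2..pi} ?f"
    using int by (intro Henstock_Kurzweil_Integration.integral_combine[symmetric]) auto
  \<comment> \<open>Reflection at 0 followed by a shift by pi maps the second quarter onto the
    first; \<open>\<bar>sin x\<bar>\<close> is invariant under both.\<close>
  also have "integral {pi / 2..pi} ?f = integral {0..pi / 2} ?f"
  proof -
    have "integral {- pi..- (pi / 2)} (\<lambda>x. ?f (- x)) = integral {pi / 2..pi} ?f"
      by (rule Henstock_Kurzweil_Integration.integral_reflect_real)
    moreover have "integral {- pi..- (pi / 2)} ?f = integral {0..pi / 2} ?f"
      using integral_shift[of "- pi" pi "- (pi / 2)" ?f] cont by (simp add: comp_def)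
    ultimately show ?thesis by simp
  qed
  finally have "integral {0..2 * pi} (\<lambda>x. \<bar>cos x\<bar> powr d) = 2 * Beta ((d + 1) / 2) (1 / 2)"
    using integral_sin_powr[OF d] by simp
  then have "integral {0..2 * pi} (\<lambda>x. \<bar>2 * cos x\<bar> powr d)
      = 2 powr d * (2 * Beta ((d + 1) / 2) (1 / 2))"
    by (simp add: abs_mult powr_mult)
  also have "\<dots> = 2 powr d * 2 * sqrt pi * Gamma ((d + 1) / 2) / Gamma (d / 2 + 1)"
    by (simp add: Beta_def Gamma_one_half_real add_divide_distrib add.assoc)
  \<comment> \<open>Expanding by \<open>Gamma (d / 2 + 1)\<close> creates the product to which the
    duplication formula applies and the square in the denominator of
    \<open>central_binomial\<close>.\<close>
  also have "\<dots> = 2 * (2 powr d * sqrt pi * (Gamma ((d + 1) / 2) * Gamma (d / 2 + 1)))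
      / (Gamma (d / 2 + 1))\<^sup>2"
  proof -
    have "0 < Gamma (d / 2 + 1)" using d by (intro Gamma_real_pos) auto
    then show ?thesis by (simp add: power2_eq_square)
  qed
  also have "Gamma ((d + 1) / 2) * Gamma (d / 2 + 1) = 2 powr (- d) * sqrt pi * Gamma (d + 1)"
  proof -
    have "(d + 1) / 2 + 1 / 2 = d / 2 + 1" "1 - 2 * ((d + 1) / 2) = - d" "2 * ((d + 1) / 2) = d + 1"
      by (simp_all add: field_simps)
    then show ?thesis using Gamma_duplication_real[of "(d + 1) / 2"] d by (simp only:)
  qed
  also have "2 powr d * sqrt pi * (2 powr (- d) * sqrt pi * Gamma (d + 1)) = pi * Gamma (d + 1)"
  proof -
    have "2 powr d * sqrt pi * (2 powr (- d) * sqrt pi * Gamma (d + 1))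
        = (2 powr d * 2 powr (- d)) * (sqrt pi * sqrt pi) * Gamma (d + 1)"
      by (simp only: mult_ac)
    also have "2 powr d * 2 powr (- d) = (1 :: real)" by (simp flip: powr_add)
    finally show ?thesis by simp
  qed
  also have "2 * (pi * Gamma (d + 1)) / (Gamma (d / 2 + 1))\<^sup>2 = 2 * pi * central_binomial d"
    by (simp add: central_binomial_def)
  finally show ?thesis .
qed

section \<open>Extension of a norm from Hermitian to all matrices\<close>

text \<open>Twice the Hermitian part of the matrix \<open>Z\<close> turned by the phase
  \<open>cis t\<close>.\<close>

definition rotated_real_part :: "complex mat \<Rightarrow> real \<Rightarrow> complex mat" where
  "rotated_real_part Z t = exp (\<i> * complex_of_real t) \<cdot>\<^sub>m Z
    + exp (- (\<i> * complex_of_real t)) \<cdot>\<^sub>m mat_adjoint Z"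

lemma rotated_real_part_carrier [simp]:
  "Z \<in> carrier_mat n n \<Longrightarrow> rotated_real_part Z t \<in> carrier_mat n n"
  by (simp add: rotated_real_part_def)

lemma dim_rotated_real_part [simp]:
  "dim_row (rotated_real_part Z t) = dim_col Z" "dim_col (rotated_real_part Z t) = dim_row Z"
  by (simp_all add: rotated_real_part_def)

lemma rotated_real_part_index:
  assumes "Z \<in> carrier_mat n n" "i < n" "j < n"
  shows "rotated_real_part Z t $$ (i, j) = cis t * Z $$ (i, j) + cnj (cis t * Z $$ (j, i))"
proof -
  have "exp (\<i> * complex_of_real t) = cis t" by (simp add: cis_conv_exp)
  moreover have "exp (- (\<i> * complex_of_real t)) = cnj (cis t)"
    using cis_conv_exp[of "- t"] by (simp add: cis_cnj)
  ultimately show ?thesis using assms by (simp add: rotated_real_part_def)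
qed

lemma rotated_real_part_hermitian:
  "Z \<in> carrier_mat n n \<Longrightarrow> rotated_real_part Z t \<in> hermitian_mats n"
  by (intro hermitian_matsI) (auto simp: rotated_real_part_index add.commute)

lemma rotated_real_part_add:
  assumes "Z \<in> carrier_mat n n" "W \<in> carrier_mat n n"
  shows "rotated_real_part (Z + W) t = rotated_real_part Z t + rotated_real_part W t"
proof (rule eq_matI)
  fix i j assume "i < dim_row (rotated_real_part Z t + rotated_real_part W t)"
    "j < dim_col (rotated_real_part Z t + rotated_real_part W t)"
  then have "i < n" "j < n" using assms by auto
  then show "rotated_real_part (Z + W) t $$ (i, j)
      = (rotated_real_part Z t + rotated_real_part W t) $$ (i, j)"
    using assms by (simp add: rotated_real_part_index[of _ n] algebra_simps)
qed (use assms in auto)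

text \<open>The modulus of \<open>c\<close> factors out and its phase is absorbed by the angle.
  \<open>Arg2pi\<close> has the range that \<open>integral_periodic_shift\<close> asks for.\<close>

lemma rotated_real_part_smult:
  assumes Z: "Z \<in> carrier_mat n n"
  shows "rotated_real_part (c \<cdot>\<^sub>m Z) t
    = complex_of_real (cmod c) \<cdot>\<^sub>m rotated_real_part Z (t + Arg2pi c)"
proof (rule eq_matI)
  fix i j assume "i < dim_row (complex_of_real (cmod c) \<cdot>\<^sub>m rotated_real_part Z (t + Arg2pi c))"
    "j < dim_col (complex_of_real (cmod c) \<cdot>\<^sub>m rotated_real_part Z (t + Arg2pi c))"
  then have ij: "i < n" "j < n" using Z by auto
  have "c = complex_of_real (cmod c) * cis (Arg2pi c)"
    using Arg2pi[of c] unfolding is_Arg_def cis_conv_exp by blast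
  then have "cis t * c = complex_of_real (cmod c) * cis (t + Arg2pi c)"
    by (metis cis_mult mult.left_commute)
  then have eq: "cis t * (c * z) = complex_of_real (cmod c) * (cis (t + Arg2pi c) * z)" for z
    by (metis mult.assoc)
  have "rotated_real_part (c \<cdot>\<^sub>m Z) t $$ (i, j)
      = cis t * (c * Z $$ (i, j)) + cnj (cis t * (c * Z $$ (j, i)))"
    using Z ij by (subst rotated_real_part_index[of _ n]) auto
  also have "\<dots> = complex_of_real (cmod c) * rotated_real_part Z (t + Arg2pi c) $$ (i, j)"
    unfolding eq using Z ij by (simp add: rotated_real_part_index[of _ n] distrib_left)
  finally show "rotated_real_part (c \<cdot>\<^sub>m Z) t $$ (i, j)
      = (complex_of_real (cmod c) \<cdot>\<^sub>m rotated_real_part Z (t + Arg2pi c)) $$ (i, j)"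
    using Z ij by simp
qed (use Z in auto)

lemma rotated_real_part_of_hermitian:
  assumes A: "A \<in> hermitian_mats n"
  shows "rotated_real_part A t = complex_of_real (2 * cos t) \<cdot>\<^sub>m A"
proof (rule eq_matI)
  note Ac = hermitian_mats_carrier[OF A]
  fix i j assume "i < dim_row (complex_of_real (2 * cos t) \<cdot>\<^sub>m A)"
    "j < dim_col (complex_of_real (2 * cos t) \<cdot>\<^sub>m A)"
  then have ij: "i < n" "j < n" using Ac by auto
  have "rotated_real_part A t $$ (i, j) = (cis t + cnj (cis t)) * A $$ (i, j)"
    using Ac ij hermitian_mats_index[OF A, of j i]
    by (simp add: rotated_real_part_index[of _ n] distrib_right)
  also have "cis t + cnj (cis t) = complex_of_real (2 * cos t)" by (simp add: complex_eq_iff)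
  finally show "rotated_real_part A t $$ (i, j) = (complex_of_real (2 * cos t) \<cdot>\<^sub>m A) $$ (i, j)"
    using Ac ij by simp
qed (use hermitian_mats_carrier[OF A] in auto)

text \<open>The curve is \<open>cos t\<close> times its value at 0 plus \<open>sin t\<close> times
  its value at pi / 2. The difference form prepares the continuity estimate
  \<open>slice_diff_le\<close>.\<close>

lemma rotated_real_part_diff:
  assumes Z: "Z \<in> carrier_mat n n"
  shows "rotated_real_part Z t = rotated_real_part Z s
    + (complex_of_real (cos t - cos s) \<cdot>\<^sub>m rotated_real_part Z 0
      + complex_of_real (sin t - sin s) \<cdot>\<^sub>m rotated_real_part Z (pi / 2))"
    (is "_ = ?R")
proof (rule eq_matI)
  show "dim_row (rotated_real_part Z t) = dim_row ?R" "dim_col (rotated_real_part Z t) = dim_col ?R"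
    by auto
  fix i j assume "i < dim_row ?R" "j < dim_col ?R"
  then have ij: "i < n" "j < n" using Z by auto
  have "rotated_real_part Z u $$ (i, j) = complex_of_real (cos u) * rotated_real_part Z 0 $$ (i, j)
      + complex_of_real (sin u) * rotated_real_part Z (pi / 2) $$ (i, j)" for u
    using Z ij by (simp add: rotated_real_part_index[of _ n] complex_eq_iff algebra_simps)
  from this[of t] this[of s] show "rotated_real_part Z t $$ (i, j) = ?R $$ (i, j)"
    using Z ij by (simp add: algebra_simps)
qed

text \<open>The two values are \<open>Z\<close> plus its adjoint and \<open>\<i>\<close> times
  \<open>Z\<close> minus its adjoint, which together determine \<open>Z\<close>.\<close>

lemma rotated_real_part_zero_imp:
  assumes Z: "Z \<in> carrier_mat n n"
    and zero: "rotated_real_part Z 0 = 0\<^sub>m n n" "rotated_real_part Z (pi / 2) = 0\<^sub>m n n"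
  shows "Z = 0\<^sub>m n n"
proof (rule eq_matI)
  fix i j assume "i < dim_row (0\<^sub>m n n :: complex mat)" "j < dim_col (0\<^sub>m n n :: complex mat)"
  then have ij: "i < n" "j < n" by auto
  have "Z $$ (i, j) + cnj (Z $$ (j, i)) = 0"
    using rotated_real_part_index[OF Z ij, of 0] ij by (simp add: zero)
  moreover have "\<i> * (Z $$ (i, j) - cnj (Z $$ (j, i))) = 0"
    using rotated_real_part_index[OF Z ij, of "pi / 2"] ij by (simp add: zero algebra_simps)
  ultimately show "Z $$ (i, j) = 0\<^sub>m n n $$ (i, j)"
    using ij by (simp add: complex_eq_iff)
qed (use Z in auto)

section \<open>The averaged norm on all matrices\<close>

locale hermitian_norm =
  fixes n :: nat and N :: "complex mat \<Rightarrow> real" and d :: real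
  assumes d_ge_1: "1 \<le> d"
    and nonneg: "0 \<le> N A"
    and definite: "A \<in> hermitian_mats n \<Longrightarrow> N A = 0 \<Longrightarrow> A = 0\<^sub>m n n"
    and smult: "A \<in> hermitian_mats n \<Longrightarrow> N (complex_of_real c \<cdot>\<^sub>m A) = \<bar>c\<bar> * N A"
    and triangle: "A \<in> hermitian_mats n \<Longrightarrow> B \<in> hermitian_mats n \<Longrightarrow> N (A + B) \<le> N A + N B"
begin

abbreviation slice :: "complex mat \<Rightarrow> real \<Rightarrow> real" where
  "slice Z t \<equiv> N (rotated_real_part Z t)"

definition slice_integral :: "complex mat \<Rightarrow> real" where
  "slice_integral Z = (LINT t:{0..2 * pi}|lborel. slice Z t powr d)"

definition extension :: "complex mat \<Rightarrow> real" where
  "extension Z = (1 / (2 * pi * central_binomial d) * slice_integral Z) powr (1 / d)"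

text \<open>By the triangle inequality the increment of the slice is at most \<open>N\<close> of the
  increment of the curve. This yields continuity in \<open>t\<close> from the norm axioms alone,
  without a topology on matrices.\<close>

lemma slice_diff_le:
  assumes Z: "Z \<in> carrier_mat n n"
  shows "slice Z t - slice Z s \<le> \<bar>cos t - cos s\<bar> * slice Z 0 + \<bar>sin t - sin s\<bar> * slice Z (pi / 2)"
proof -
  note H = rotated_real_part_hermitian[OF Z]
  let ?P = "complex_of_real (cos t - cos s) \<cdot>\<^sub>m rotated_real_part Z 0"
  let ?Q = "complex_of_real (sin t - sin s) \<cdot>\<^sub>m rotated_real_part Z (pi / 2)"
  have PQ: "?P \<in> hermitian_mats n" "?Q \<in> hermitian_mats n" by (intro hermitian_mats_smult H)+
  have "slice Z t \<le> slice Z s + N (?P + ?Q)"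
    by (subst rotated_real_part_diff[OF Z, of t s]) (intro triangle hermitian_mats_add H PQ)
  also have "N (?P + ?Q) \<le> N ?P + N ?Q" by (rule triangle[OF PQ])
  finally show ?thesis unfolding smult[OF H] by simp
qed

lemma continuous_on_slice:
  assumes Z: "Z \<in> carrier_mat n n"
  shows "continuous_on S (slice Z)"
proof -
  have "isCont (slice Z) s" for s
  proof -
    define g where "g = (\<lambda>t. \<bar>cos t - cos s\<bar> * slice Z 0 + \<bar>sin t - sin s\<bar> * slice Z (pi / 2))"
    have "isCont g s" unfolding g_def by (intro continuous_intros)
    then have g: "g \<midarrow>s\<rightarrow> 0" by (simp add: isCont_def g_def)
    have "norm (slice Z t - slice Z s) \<le> g t" for t
      using slice_diff_le[OF Z, of t s] slice_diff_le[OF Z, of s t]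
      by (simp add: g_def abs_le_iff abs_minus_commute)
    then have "(\<lambda>t. slice Z t - slice Z s) \<midarrow>s\<rightarrow> 0"
      by (intro Lim_null_comparison[OF _ g]) simp
    then show ?thesis by (simp add: isCont_def LIM_zero_iff)
  qed
  then show ?thesis by (intro continuous_at_imp_continuous_on) auto
qed

lemma continuous_on_slice_powr:
  assumes "Z \<in> carrier_mat n n"
  shows "continuous_on S (\<lambda>t. slice Z t powr d)"
  using continuous_on_abs_powr[OF continuous_on_slice[OF assms], of d] d_ge_1 nonneg by simp

lemma set_integrable_slice_powr:
  "Z \<in> carrier_mat n n \<Longrightarrow> set_integrable lborel {0..2 * pi} (\<lambda>t. slice Z t powr d)"
  by (intro borel_integrable_atLeastAtMost' continuous_on_slice_powr)

text \<open>In this form the shift lemma, the cosine integral and the criterion for a vanishing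
  integral apply.\<close>

lemma slice_integral_eq:
  "Z \<in> carrier_mat n n \<Longrightarrow> slice_integral Z = integral {0..2 * pi} (\<lambda>t. slice Z t powr d)"
  unfolding slice_integral_def by (intro set_borel_integral_eq_integral set_integrable_slice_powr)

lemma slice_integral_nonneg: "Z \<in> carrier_mat n n \<Longrightarrow> 0 \<le> slice_integral Z"
  unfolding slice_integral_def set_lebesgue_integral_def by (intro integral_nonneg_AE) auto

lemma extension_eq:
  "extension Z = (1 / (2 * pi * central_binomial d)) powr (1 / d) * slice_integral Z powr (1 / d)"
  unfolding extension_def by (rule powr_mult)

lemma extension_smult:
  assumes Z: "Z \<in> carrier_mat n n"
  shows "extension (c \<cdot>\<^sub>m Z) = cmod c * extension Z"
proof -
  have "slice (c \<cdot>\<^sub>m Z) t powr d = cmod c powr d * slice Z (t + Arg2pi c) powr d" for t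
    by (simp add: rotated_real_part_smult[OF Z] smult[OF rotated_real_part_hermitian[OF Z]]
        powr_mult)
  then have "slice_integral (c \<cdot>\<^sub>m Z)
      = cmod c powr d * integral {0..2 * pi} (\<lambda>t. slice Z (t + Arg2pi c) powr d)"
    using Z by (simp add: slice_integral_eq)
  also have "integral {0..2 * pi} (\<lambda>t. slice Z (t + Arg2pi c) powr d) = slice_integral Z"
    unfolding slice_integral_eq[OF Z]
  proof (rule integral_periodic_shift[where f = "\<lambda>t. slice Z t powr d"])
    show "continuous_on UNIV (\<lambda>t. slice Z t powr d)" by (rule continuous_on_slice_powr[OF Z])
    show "0 \<le> Arg2pi c" "Arg2pi c \<le> 2 * pi" using Arg2pi[of c] by simp_all
    fix t
    have "rotated_real_part Z (t + 2 * pi) = rotated_real_part Z t"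
    proof (rule eq_matI)
      fix i j assume "i < dim_row (rotated_real_part Z t)" "j < dim_col (rotated_real_part Z t)"
      moreover have "cis (t + 2 * pi) = cis t" by (simp add: complex_eq_iff)
      ultimately show "rotated_real_part Z (t + 2 * pi) $$ (i, j) = rotated_real_part Z t $$ (i, j)"
        using Z by (simp add: rotated_real_part_index[of _ n])
    qed auto
    then show "slice Z (t + 2 * pi) powr d = slice Z t powr d" by simp
  qed
  finally show ?thesis using d_ge_1 by (simp add: extension_eq powr_mult powr_powr)
qed

lemma extension_triangle:
  assumes Z: "Z \<in> carrier_mat n n" and W: "W \<in> carrier_mat n n"
  shows "extension (Z + W) \<le> extension Z + extension W"
proof -
  \<comment> \<open>Building the interval into the function turns the slice integral into one over
    the whole line, as in \<open>Minkowski_inequality\<close>; outside the interval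
    \<open>0 powr d = 0\<close>.\<close>
  define f where "f = (\<lambda>Z t. indicator {0..2 * pi} t * slice Z t)"
  have f_powr: "\<bar>f Z t\<bar> powr d = indicator {0..2 * pi} t *\<^sub>R slice Z t powr d" for Z t
    using nonneg d_ge_1 by (auto simp: f_def indicator_def)
  have f_int: "integrable lborel (\<lambda>t. \<bar>f Z t\<bar> powr d)" if "Z \<in> carrier_mat n n" for Z
    using set_integrable_slice_powr[OF that] by (simp add: f_powr set_integrable_def)
  have f_integral: "slice_integral Z = (LINT t|lborel. \<bar>f Z t\<bar> powr d)" for Z
    by (simp add: slice_integral_def set_lebesgue_integral_def f_powr)
  have f_meas: "f Z \<in> borel_measurable lborel" if "Z \<in> carrier_mat n n" for Z
    using borel_measurable_continuous_onI[OF continuous_on_slice[OF that]] by (simp add: f_def)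
  have ZW: "Z + W \<in> carrier_mat n n" using Z W by simp
  have "slice_integral (Z + W) \<le> (LINT t|lborel. \<bar>f Z t + f W t\<bar> powr d)"
    unfolding f_integral
  proof (intro integral_mono f_int ZW integrable_abs_powr_add d_ge_1 f_meas Z W)
    fix t
    have "slice (Z + W) t \<le> slice Z t + slice W t"
      unfolding rotated_real_part_add[OF Z W] by (intro triangle rotated_real_part_hermitian Z W)
    then have "0 \<le> f (Z + W) t" "f (Z + W) t \<le> f Z t + f W t"
      using nonneg by (auto simp: f_def indicator_def)
    then show "\<bar>f (Z + W) t\<bar> powr d \<le> \<bar>f Z t + f W t\<bar> powr d"
      using d_ge_1 by (intro powr_mono2) auto
  qed
  then have "slice_integral (Z + W) powr (1 / d)
      \<le> (LINT t|lborel. \<bar>f Z t + f W t\<bar> powr d) powr (1 / d)"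
    using d_ge_1 slice_integral_nonneg[OF ZW] by (intro powr_mono2) auto
  also have "\<dots> \<le> slice_integral Z powr (1 / d) + slice_integral W powr (1 / d)"
    unfolding f_integral by (intro Minkowski_inequality d_ge_1 f_meas f_int Z W)
  finally show ?thesis
    unfolding extension_eq distrib_left[symmetric] by (intro mult_left_mono) auto
qed

text \<open>A continuous nonnegative function with integral 0 vanishes at every angle of the
  interval; the angles 0 and pi / 2 already recover \<open>Z\<close>.\<close>

lemma extension_eq_0_iff:
  assumes Z: "Z \<in> carrier_mat n n"
  shows "extension Z = 0 \<longleftrightarrow> Z = 0\<^sub>m n n"
proof
  assume "Z = 0\<^sub>m n n"
  then have "Z = 0 \<cdot>\<^sub>m Z" by auto
  then show "extension Z = 0" using extension_smult[OF Z, of 0] by simp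
next
  assume "extension Z = 0"
  then have "slice_integral Z = 0"
    using central_binomial_pos[OF d_ge_1] by (simp add: extension_def)
  then have "\<forall>t\<in>{0..2 * pi}. slice Z t powr d = 0"
    unfolding slice_integral_eq[OF Z]
    by (subst (asm) integral_eq_0_iff) (auto intro: continuous_on_slice_powr Z)
  then have "slice Z 0 = 0" "slice Z (pi / 2) = 0" by auto
  then show "Z = 0\<^sub>m n n"
    using definite rotated_real_part_hermitian[OF Z] rotated_real_part_zero_imp[OF Z] by blast
qed

lemma extension_of_hermitian:
  assumes A: "A \<in> hermitian_mats n"
  shows "extension A = N A"
proof -
  note Ac = hermitian_mats_carrier[OF A]
  have "slice A t powr d = \<bar>2 * cos t\<bar> powr d * N A powr d" for t
    unfolding rotated_real_part_of_hermitian[OF A] smult[OF A] by (rule powr_mult)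
  then have "slice_integral A = 2 * pi * central_binomial d * N A powr d"
    unfolding slice_integral_eq[OF Ac] using integral_abs_cos_powr[OF d_ge_1] by simp
  then show ?thesis
    using central_binomial_pos[OF d_ge_1] d_ge_1 nonneg by (simp add: extension_def powr_powr)
qed

theorem norm_on_complex_mats_extension: "norm_on_complex_mats n extension"
  unfolding norm_on_complex_mats_def
  using extension_eq_0_iff extension_smult extension_triangle by (auto simp: extension_def)

end

section \<open>Application to the random vector norm\<close>

lemma (in iid_vector) hermitian_norm_random_vector_norm:
  "hermitian_norm n (random_vector_norm M X d) d"
proof
  \<comment> \<open>Here \<open>dim_row A\<close> is \<open>n\<close>, so both sums run over the
    same indices.\<close>
  have eq: "random_vector_norm M X d A = spectral A" if "A \<in> hermitian_mats n" for A
    using hermitian_mats_carrier[OF that]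
    by (simp add: random_vector_norm_def spectral_def inner_norm_def)
  show "1 \<le> d" by (rule d_ge_1)
  show "0 \<le> random_vector_norm M X d A" for A by (simp add: random_vector_norm_def)
  show "A = 0\<^sub>m n n" if "A \<in> hermitian_mats n" "random_vector_norm M X d A = 0" for A
    using that inner_norm_eq_0_imp by (intro spectral_eq_0_imp[of A]) (simp_all add: eq)
  show "random_vector_norm M X d (complex_of_real c \<cdot>\<^sub>m A) = \<bar>c\<bar> * random_vector_norm M X d A"
    if "A \<in> hermitian_mats n" for A c
    using that spectral_smult by (simp add: eq hermitian_mats_smult)
  show "random_vector_norm M X d (A + B) \<le> random_vector_norm M X d A + random_vector_norm M X d B"
    if "A \<in> hermitian_mats n" "B \<in> hermitian_mats n" for A B
    using that spectral_triangle by (simp add: eq hermitian_mats_add)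
qed

theorem corollary1:
  fixes d :: real and n :: nat
    and M :: "'a measure" and X :: "nat \<Rightarrow> 'a \<Rightarrow> real"
  assumes "d \<ge> 1" and "n \<ge> 1"
    and "prob_space M"
    and "\<And>i. i < n \<Longrightarrow> X i \<in> borel_measurable M"
    and "\<And>i. i < n \<Longrightarrow> integrable M (\<lambda>\<omega>. \<bar>X i \<omega>\<bar> powr d)"
    and "\<And>i. i < n \<Longrightarrow> \<not> (\<exists>c. AE \<omega> in M. X i \<omega> = c)"
    and "prob_space.indep_vars M (\<lambda>_. borel) X {..<n}"
    and "\<And>i j. i < n \<Longrightarrow> j < n \<Longrightarrow> distr M borel (X i) = distr M borel (X j)"
  shows "norm_on_complex_mats n (random_vector_norm_ext M X d) \<and>
    (\<forall>A \<in> hermitian_mats n. random_vector_norm_ext M X d A = random_vector_norm M X d A)"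
proof -
  interpret iid_vector M X d n
    by (intro iid_vector.intro iid_vector_axioms.intro assms) (use assms(2) in simp)
  interpret N: hermitian_norm n "random_vector_norm M X d" d
    by (rule hermitian_norm_random_vector_norm)
  have "random_vector_norm_ext M X d = N.extension"
    by (rule ext) (simp only: random_vector_norm_ext_def N.extension_def N.slice_integral_def
        rotated_real_part_def)
  then show ?thesis using N.norm_on_complex_mats_extension N.extension_of_hermitian by simp
qed

end
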